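(* Let $(X_n)_{n\ge0}$ be an irreducible, aperiodic, reversible Markov chain on $[d]$ with stationary distribution $\pi$, started in stationarity ($X_0\sim\pi$), let $f:[d]\to[0,1]$ and $\mu=\mathbb{E}_\pi[f]$. Let $0<r<1$ and $0<\alpha\le\frac25$. Consider the testing procedures $\mathcal{A}_{\mathrm{fixed}}$, $\mathcal{A}_{\mathrm{seq}}$ (for hypotheses with indifference parameter $\delta$, where $0<\delta<\min(\mu,1-\mu)$) and $\mathcal{A}_{\mathrm{hard}}$ (for hypotheses with $\delta=0$) defined in the context. For $\mathcal{A}=\mathcal{A}_{\mathrm{fixed}},\mathcal{A}_{\mathrm{seq}},\mathcal{A}_{\mathrm{hard}}$ to satisfy $\mathrm{err}(\mathcal{A},f)\le\alpha$, it suffices to choose, respectively, $$N=\frac{2\,T_f(\delta)\log(1/\alpha)}{\delta^2}\ \text{(rounded up to an integer)},\qquad M=\frac{8\,T_f(\delta/2)\log\big(\frac{2}{\sqrt{\alpha\xi}}\big)}{\delta},$$ $$\epsilon_k(\alpha)=\inf\Big\{\epsilon>0 : \frac{\epsilon^2}{8\,T_f(\epsilon/2)}\ge\frac{\log(1/\alpha)+1+2\log k}{N_k}\Big\},$$ where $\inf\emptyset=\infty$.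
   Context: $f$-mixing time: with $\pi_n^{(i)}$ the law of $X_n$ given $X_0=i$, $d_f(p,q)=|\mathbb{E}_p[f]-\mathbb{E}_q[f]|$ and $\mathbb{N}=\{1,2,\dots\}$, $T_f(\delta)=\min\{n\in\mathbb{N} : \max_{i\in[d]}d_f(\pi_n^{(i)},\pi)\le\delta\}$. Testing problem: for a threshold $0<r<1$ and $\delta\ge0$, choose between $H_0:\mu\ge r+\delta$ and $H_1:\mu\le r-\delta$. The error of a procedure $\mathcal{A}$ is $\mathrm{err}(\mathcal{A},f)=\mathbb{P}(\mathcal{A}(X_{1:\infty})=H_1)$ if $H_0$ holds, $\mathbb{P}(\mathcal{A}(X_{1:\infty})=H_0)$ if $H_1$ holds, and $0$ otherwise. Write $\hat\mu_N=\frac1N\sum_{n=1}^Nf(X_n)$. $\mathcal{A}_{\mathrm{fixed}}$ ($\delta>0$): collect $N$ samples; output $H_0$ if $\hat\mu_N\ge r+\delta$, $H_1$ if $\hat\mu_N\le r-\delta$, and a special indifference symbol otherwise. $\mathcal{A}_{\mathrm{seq}}$ ($\delta>0$), with parameters $M>0$ and $0<\xi<2/5$: let $N_0=\lfloor M\min(\frac1r,\frac1{1-r})\rfloor$ and $N_k=\lfloor N_0(1+\xi)^k\rfloor$. At each time $N_k$, $k\ge1$, if $\hat\mu_{N_k}\in(r-\frac{M}{N_k},r+\frac{M}{N_k})$ continue sampling; otherwise stop and output $H_0$ if $\hat\mu_{N_k}\ge r+\frac{M}{N_k}$ and $H_1$ if $\hat\mu_{N_k}\le r-\frac{M}{N_k}$.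 $\mathcal{A}_{\mathrm{hard}}$ ($\delta=0$): let $N_0$ be an arbitrary positive integer, and $N_k=\lfloor N_0(1+\xi)^k\rfloor$ with $0<\xi<2/5$. At each time $N_k$, $k\ge1$, if $\hat\mu_{N_k}\in(r-\epsilon_k(\alpha),r+\epsilon_k(\alpha))$ continue sampling; otherwise stop and output $H_0$ if $\hat\mu_{N_k}\ge r+\epsilon_k(\alpha)$ and $H_1$ if $\hat\mu_{N_k}\le r-\epsilon_k(\alpha)$. *)

theory Defs
  imports "HOL-Probability.Probability"
begin

fun nstep :: "('d \<Rightarrow> 'd pmf) \<Rightarrow> nat \<Rightarrow> 'd \<Rightarrow> 'd pmf" where
  "nstep K 0 i = return_pmf i"
| "nstep K (Suc n) i = bind_pmf (nstep K n i) K"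

definition irreducible_kernel :: "('d \<Rightarrow> 'd pmf) \<Rightarrow> bool" where
  "irreducible_kernel K \<longleftrightarrow> (\<forall>i j. \<exists>n. pmf (nstep K n i) j > 0)"

definition aperiodic_kernel :: "('d \<Rightarrow> 'd pmf) \<Rightarrow> bool" where
  "aperiodic_kernel K \<longleftrightarrow> (\<forall>i. Gcd {n. n \<ge> 1 \<and> pmf (nstep K n i) i > 0} = 1)"

definition stationary :: "('d \<Rightarrow> 'd pmf) \<Rightarrow> 'd pmf \<Rightarrow> bool" where
  "stationary K \<pi> \<longleftrightarrow> bind_pmf \<pi> K = \<pi>"

definition reversible :: "('d \<Rightarrow> 'd pmf) \<Rightarrow> 'd pmf \<Rightarrow> bool" where
  "reversible K \<pi> \<longleftrightarrow> (\<forall>i j. pmf \<pi> i * pmf (K i) j = pmf \<pi> j * pmf (K j) i)"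

definition markov_chain ::
  "'a measure \<Rightarrow> ('d \<Rightarrow> 'd pmf) \<Rightarrow> 'd pmf \<Rightarrow> (nat \<Rightarrow> 'a \<Rightarrow> 'd) \<Rightarrow> bool" where
  "markov_chain \<Omega> K \<nu> X \<longleftrightarrow>
     prob_space \<Omega> \<and>
     (\<forall>n. X n \<in> measurable \<Omega> (count_space UNIV)) \<and>
     distr \<Omega> (count_space UNIV) (X 0) = measure_pmf \<nu> \<and>
     (\<forall>n x j. \<P>(\<omega> in \<Omega>. \<forall>k\<le>n. X k \<omega> = x k) > 0 \<longrightarrow>
        \<P>(\<omega> in \<Omega>. X (Suc n) \<omega> = j \<bar> \<forall>k\<le>n. X k \<omega> = x k) = pmf (K (x n)) j)"

definition f_dist :: "('d \<Rightarrow> real) \<Rightarrow> 'd pmf \<Rightarrow> 'd pmf \<Rightarrow> real" where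
  "f_dist f p q = \<bar>measure_pmf.expectation p f - measure_pmf.expectation q f\<bar>"

definition f_mixing_time ::
  "('d::finite \<Rightarrow> 'd pmf) \<Rightarrow> 'd pmf \<Rightarrow> ('d \<Rightarrow> real) \<Rightarrow> real \<Rightarrow> nat" where
  "f_mixing_time K \<pi> f \<delta> =
     (LEAST n. n \<ge> 1 \<and> (MAX i\<in>UNIV. f_dist f (nstep K n i) \<pi>) \<le> \<delta>)"

text \<open>The value \<open>Never\<close> is the result of a sequential procedure that samples forever.\<close>

datatype outcome = H0 | H1 | Indifferent | Never

text \<open>
  A procedure maps a trajectory to an outcome. Trajectories are indexed from \<open>0\<close>, but
  procedures only inspect the samples with index at least \<open>1\<close>.

  For \<open>\<delta> = 0\<close> and mean equal to \<open>r\<close> both hypotheses hold; taking the maximum then demands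
  control of both error probabilities.
\<close>

definition test_err ::
  "'a measure \<Rightarrow> (nat \<Rightarrow> 'a \<Rightarrow> 'd) \<Rightarrow> 'd pmf \<Rightarrow> ('d \<Rightarrow> real) \<Rightarrow> real \<Rightarrow> real \<Rightarrow>
     ((nat \<Rightarrow> 'd) \<Rightarrow> outcome) \<Rightarrow> real" where
  "test_err \<Omega> X \<pi> f r \<delta> A =
     (let \<mu> = measure_pmf.expectation \<pi> f in
      max (if \<mu> \<ge> r + \<delta> then \<P>(\<omega> in \<Omega>. A (\<lambda>n. X n \<omega>) = H1) else 0)
          (if \<mu> \<le> r - \<delta> then \<P>(\<omega> in \<Omega>. A (\<lambda>n. X n \<omega>) = H0) else 0))"

definition emp_mean :: "('d \<Rightarrow> real) \<Rightarrow> nat \<Rightarrow> (nat \<Rightarrow> 'd) \<Rightarrow> real" where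
  "emp_mean f N x = (\<Sum>n=1..N. f (x n)) / real N"

definition A_fixed ::
  "('d \<Rightarrow> real) \<Rightarrow> real \<Rightarrow> real \<Rightarrow> nat \<Rightarrow> (nat \<Rightarrow> 'd) \<Rightarrow> outcome" where
  "A_fixed f r \<delta> N x =
     (if emp_mean f N x \<ge> r + \<delta> then H0
      else if emp_mean f N x \<le> r - \<delta> then H1
      else Indifferent)"

text \<open>
  Common scheme of the two sequential procedures: look at times \<open>N k\<close> for \<open>k \<ge> 1\<close>, with
  half-width \<open>\<epsilon> k > 0\<close> of the continuation interval. The half-width may be \<open>\<infinity>\<close>, in which
  case sampling always continues.
\<close>

definition stops_at ::
  "('d \<Rightarrow> real) \<Rightarrow> real \<Rightarrow> (nat \<Rightarrow> nat) \<Rightarrow> (nat \<Rightarrow> ereal) \<Rightarrow> (nat \<Rightarrow> 'd) \<Rightarrow> nat \<Rightarrow> bool" where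
  "stops_at f r N \<epsilon> x k \<longleftrightarrow>
     \<not> (ereal r - \<epsilon> k < ereal (emp_mean f (N k) x) \<and>
        ereal (emp_mean f (N k) x) < ereal r + \<epsilon> k)"

definition sequential_test ::
  "('d \<Rightarrow> real) \<Rightarrow> real \<Rightarrow> (nat \<Rightarrow> nat) \<Rightarrow> (nat \<Rightarrow> ereal) \<Rightarrow> (nat \<Rightarrow> 'd) \<Rightarrow> outcome" where
  "sequential_test f r N \<epsilon> x =
     (if \<exists>k\<ge>1. stops_at f r N \<epsilon> x k then
        let k = (LEAST k. k \<ge> 1 \<and> stops_at f r N \<epsilon> x k) in
        if ereal (emp_mean f (N k) x) \<ge> ereal r + \<epsilon> k then H0 else H1
      else Never)"

definition geom_times :: "nat \<Rightarrow> real \<Rightarrow> nat \<Rightarrow> nat" where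
  "geom_times N0 \<xi> k = nat \<lfloor>real N0 * (1 + \<xi>) ^ k\<rfloor>"

definition seq_times :: "real \<Rightarrow> real \<Rightarrow> real \<Rightarrow> nat \<Rightarrow> nat" where
  "seq_times r M \<xi> = geom_times (nat \<lfloor>M * min (1 / r) (1 / (1 - r))\<rfloor>) \<xi>"

text \<open>Division is taken in \<open>ereal\<close>, so the half-width \<open>M / N\<^sub>k\<close> is \<open>\<infinity>\<close> should \<open>N\<^sub>k = 0\<close>.\<close>

definition A_seq ::
  "('d \<Rightarrow> real) \<Rightarrow> real \<Rightarrow> real \<Rightarrow> real \<Rightarrow> (nat \<Rightarrow> 'd) \<Rightarrow> outcome" where
  "A_seq f r M \<xi> =
     sequential_test f r (seq_times r M \<xi>) (\<lambda>k. ereal M / ereal (real (seq_times r M \<xi> k)))"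

definition A_hard ::
  "('d \<Rightarrow> real) \<Rightarrow> real \<Rightarrow> nat \<Rightarrow> real \<Rightarrow> (nat \<Rightarrow> ereal) \<Rightarrow> (nat \<Rightarrow> 'd) \<Rightarrow> outcome" where
  "A_hard f r N0 \<xi> \<epsilon> = sequential_test f r (geom_times N0 \<xi>) \<epsilon>"

definition N_fixed ::
  "('d::finite \<Rightarrow> 'd pmf) \<Rightarrow> 'd pmf \<Rightarrow> ('d \<Rightarrow> real) \<Rightarrow> real \<Rightarrow> real \<Rightarrow> nat" where
  "N_fixed K \<pi> f \<alpha> \<delta> =
     nat \<lceil>2 * real (f_mixing_time K \<pi> f \<delta>) * ln (1 / \<alpha>) / \<delta>\<^sup>2\<rceil>"

definition M_seq ::
  "('d::finite \<Rightarrow> 'd pmf) \<Rightarrow> 'd pmf \<Rightarrow> ('d \<Rightarrow> real) \<Rightarrow> real \<Rightarrow> real \<Rightarrow> real \<Rightarrow> real" where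
  "M_seq K \<pi> f \<alpha> \<delta> \<xi> =
     8 * real (f_mixing_time K \<pi> f (\<delta> / 2)) * ln (2 / sqrt (\<alpha> * \<xi>)) / \<delta>"

text \<open>The infimum of the empty set in \<open>ereal\<close> is \<open>\<infinity>\<close>.\<close>

definition eps_hard ::
  "('d::finite \<Rightarrow> 'd pmf) \<Rightarrow> 'd pmf \<Rightarrow> ('d \<Rightarrow> real) \<Rightarrow> real \<Rightarrow> (nat \<Rightarrow> nat) \<Rightarrow> nat \<Rightarrow> ereal" where
  "eps_hard K \<pi> f \<alpha> N k =
     Inf {ereal \<epsilon> | \<epsilon>. \<epsilon> > 0 \<and>
       \<epsilon>\<^sup>2 / (8 * real (f_mixing_time K \<pi> f (\<epsilon> / 2)))
         \<ge> (ln (1 / \<alpha>) + 1 + 2 * ln (real k)) / real (N k)}"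

end

theory Submission imports Defs begin

text \<open>
  Along an arithmetic progression of step \<open>T = T\<^sub>f(\<delta>)\<close> every sample has
  conditional mean within \<open>\<delta>\<close> of \<open>\<mu>\<close>, whatever the past. Hoeffding's lemma therefore bounds
  the exponential moment of each progression, and convexity of \<open>exp\<close> combines the \<open>T\<close>
  progressions into \<open>P(\<mu>\<^sub>N \<ge> \<mu> + \<delta> + \<epsilon>) \<le> exp (- N \<epsilon>\<^sup>2 / T)\<close> for \<open>N \<ge> T\<close>. The fixed test
  follows directly and the sequential ones by a union bound. Reversibility enters only through
  the finiteness of \<open>T\<^sub>f\<close>: it forces two-step returns, so aperiodicity amounts to an odd
  return time.
\<close>

section \<open>Moments along a Markov chain\<close>

text \<open>Every threshold is split: one share pays for the bias left after \<open>T\<close> steps,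
  the remainder is the fluctuation \<open>\<epsilon>\<close>. The split fixes the argument of
  \<open>T\<^sub>f\<close> in each test: \<open>\<delta>\<close> out of \<open>2 * \<delta>\<close>
  for the fixed test, \<open>\<delta> / 2\<close> out of \<open>\<delta> + M / N k\<close> for the
  sequential one, about half of the half-width for the hard one. Two obstacles separate this from
  the independent case. \<open>N\<close> need not be a multiple of \<open>T\<close>; rounding the
  progressions up costs a factor two in the exponent \<open>2 * N * \<epsilon>\<^sup>2 / T\<close>
  that holds when \<open>T\<close> divides \<open>N\<close>. And the first sample of a progression
  may come fewer than \<open>T\<close> steps after time 0; there stationarity replaces mixing. The
  stated constants absorb the lost factor, but each test has to secure \<open>T \<le> N\<close> on
  its own.\<close>

lemma expectation_finite:
  fixes p :: "'d::finite pmf" and h :: "'d \<Rightarrow> real"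
  shows "measure_pmf.expectation p h = (\<Sum>j\<in>UNIV. pmf p j * h j)"
  by (subst integral_measure_pmf_real[of UNIV]) (auto simp: mult.commute)

lemma expectation_bind_finite:
  fixes p :: "'c::finite pmf" and K :: "'c \<Rightarrow> 'd::finite pmf" and h :: "'d \<Rightarrow> real"
  shows "measure_pmf.expectation (bind_pmf p K) h =
    measure_pmf.expectation p (\<lambda>i. measure_pmf.expectation (K i) h)"
  unfolding expectation_finite pmf_bind
  by (simp add: sum_distrib_left sum_distrib_right mult.assoc) (rule sum.swap)

lemma expectation_mono_finite:
  fixes p :: "'d::finite pmf" and g h :: "'d \<Rightarrow> real"
  assumes "\<And>i. g i \<le> h i"
  shows "measure_pmf.expectation p g \<le> measure_pmf.expectation p h"
  unfolding expectation_finite by (intro sum_mono mult_left_mono assms) auto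

lemma expectation_le_const:
  fixes p :: "'d::finite pmf" and g :: "'d \<Rightarrow> real"
  assumes "\<And>i. g i \<le> c"
  shows "measure_pmf.expectation p g \<le> c"
  using expectation_mono_finite[of g "\<lambda>_. c" p] assms by simp

lemma expectation_ge_const:
  fixes p :: "'d::finite pmf" and g :: "'d \<Rightarrow> real"
  assumes "\<And>i. c \<le> g i"
  shows "c \<le> measure_pmf.expectation p g"
  using expectation_mono_finite[of "\<lambda>_. c" g p] assms by simp

lemma nstep_0_fun: "nstep K 0 = return_pmf"
  by (simp add: fun_eq_iff)

lemma nstep_Suc_fun: "nstep K (Suc n) = (\<lambda>i. bind_pmf (nstep K n i) K)"
  by (simp add: fun_eq_iff)

lemma stationary_nstep:
  fixes \<pi> :: "'d::finite pmf"
  assumes "stationary K \<pi>"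
  shows "bind_pmf \<pi> (nstep K n) = \<pi>"
proof (induction n)
  case 0
  show ?case by (simp add: nstep_0_fun bind_return_pmf')
next
  case (Suc n)
  with assms show ?case by (simp add: nstep_Suc_fun stationary_def flip: bind_assoc_pmf)
qed

lemma stationary_expectation_nstep:
  fixes \<pi> :: "'d::finite pmf" and h :: "'d \<Rightarrow> real"
  assumes "stationary K \<pi>"
  shows "measure_pmf.expectation \<pi> (\<lambda>i. measure_pmf.expectation (nstep K n i) h) =
    measure_pmf.expectation \<pi> h"
  by (simp add: stationary_nstep[OF assms] flip: expectation_bind_finite)

text \<open>The product form removes the positivity side condition of the Markov property: on a
  history of probability zero both sides vanish.\<close>

lemma markov_chain_cylinder:
  assumes "markov_chain \<Omega> K \<nu> X"
  shows "\<P>(\<omega> in \<Omega>. X (Suc m) \<omega> = j \<and> (\<forall>k\<le>m. X k \<omega> = x k)) =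
    \<P>(\<omega> in \<Omega>. \<forall>k\<le>m. X k \<omega> = x k) * pmf (K (x m)) j"
proof -
  interpret prob_space \<Omega> using assms by (simp add: markov_chain_def)
  have [measurable]: "X n \<in> measurable \<Omega> (count_space UNIV)" for n
    using assms by (simp add: markov_chain_def)
  show ?thesis
  proof (cases "\<P>(\<omega> in \<Omega>. \<forall>k\<le>m. X k \<omega> = x k) > 0")
    case True
    hence "\<P>(\<omega> in \<Omega>. X (Suc m) \<omega> = j \<bar> \<forall>k\<le>m. X k \<omega> = x k) = pmf (K (x m)) j"
      using assms by (simp add: markov_chain_def)
    with True show ?thesis by (simp add: cond_prob_def field_simps)
  next
    case False
    moreover have "\<P>(\<omega> in \<Omega>. X (Suc m) \<omega> = j \<and> (\<forall>k\<le>m. X k \<omega> = x k))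
      \<le> \<P>(\<omega> in \<Omega>. \<forall>k\<le>m. X k \<omega> = x k)"
      by (intro finite_measure_mono) auto
    ultimately show ?thesis
      by (metis (lifting) measure_le_0_iff mult_zero_left nless_le zero_less_measure_iff)
  qed
qed

text \<open>A function of the first \<open>m + 1\<close> samples is a finite combination of
  indicators of cylinders, and on each cylinder the kernel supplies the law of the next sample.
  Extensional functions in \<open>S\<close> give every history exactly one representative, so that
  the sum is finite.\<close>

lemma markov_chain_integral_step:
  fixes X :: "nat \<Rightarrow> 'a \<Rightarrow> 'd::finite" and h :: "'d \<Rightarrow> real" and G :: "(nat \<Rightarrow> 'd) \<Rightarrow> real"
  assumes mc: "markov_chain \<Omega> K \<nu> X"
    and past: "\<And>x y. (\<And>k. k \<le> m \<Longrightarrow> x k = y k) \<Longrightarrow> G x = G y"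
  shows "(\<integral>\<omega>. G (\<lambda>k. X k \<omega>) * h (X (Suc m) \<omega>) \<partial>\<Omega>) =
    (\<integral>\<omega>. G (\<lambda>k. X k \<omega>) * measure_pmf.expectation (K (X m \<omega>)) h \<partial>\<Omega>)"
proof -
  interpret prob_space \<Omega> using mc by (simp add: markov_chain_def)
  have [measurable]: "X n \<in> measurable \<Omega> (count_space UNIV)" for n
    using mc by (simp add: markov_chain_def)
  define S where "S = ({..m} \<rightarrow>\<^sub>E (UNIV :: 'd set))"
  have [simp]: "finite S" unfolding S_def by (intro finite_PiE) auto
  define B where "B x = {\<omega>\<in>space \<Omega>. \<forall>k\<le>m. X k \<omega> = x k}" for x
  define C where "C x j = {\<omega>\<in>space \<Omega>. X (Suc m) \<omega> = j \<and> (\<forall>k\<le>m. X k \<omega> = x k)}" for x j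
  have [measurable]: "B x \<in> sets \<Omega>" "C x j \<in> sets \<Omega>" for x j
    unfolding B_def C_def by measurable
  have BC: "measure \<Omega> (C x j) = measure \<Omega> (B x) * pmf (K (x m)) j" for x j
    unfolding B_def C_def by (rule markov_chain_cylinder[OF mc])
  have split: "u (restrict (\<lambda>k. X k \<omega>) {..m}) = (\<Sum>x\<in>S. u x * indicator (B x) \<omega>)"
    if "\<omega> \<in> space \<Omega>" for u :: "(nat \<Rightarrow> 'd) \<Rightarrow> real" and \<omega>
  proof -
    have "(\<Sum>x\<in>S. u x * indicator (B x) \<omega>) =
        (\<Sum>x\<in>{restrict (\<lambda>k. X k \<omega>) {..m}}. u x * indicator (B x) \<omega>)"
    proof (rule sum.mono_neutral_right)
      show "\<forall>x\<in>S - {restrict (\<lambda>k. X k \<omega>) {..m}}. u x * indicator (B x) \<omega> = 0"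
      proof
        fix x assume x: "x \<in> S - {restrict (\<lambda>k. X k \<omega>) {..m}}"
        have "x = restrict (\<lambda>k. X k \<omega>) {..m}" if "\<omega> \<in> B x"
          using that x by (intro ext) (auto simp: B_def S_def PiE_def extensional_def restrict_def)
        with x show "u x * indicator (B x) \<omega> = 0" by (auto simp: indicator_def)
      qed
    qed (auto simp: S_def intro!: finite_PiE)
    also have "\<dots> = u (restrict (\<lambda>k. X k \<omega>) {..m})"
      using that by (simp add: B_def)
    finally show ?thesis by simp
  qed
  have G_restrict: "G (\<lambda>k. X k \<omega>) = G (restrict (\<lambda>k. X k \<omega>) {..m})" for \<omega>
    by (rule past) auto
  have "(\<integral>\<omega>. G (\<lambda>k. X k \<omega>) * h (X (Suc m) \<omega>) \<partial>\<Omega>) =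
      (\<integral>\<omega>. (\<Sum>x\<in>S. \<Sum>j\<in>UNIV. G x * h j * indicator (C x j) \<omega>) \<partial>\<Omega>)"
  proof (rule Bochner_Integration.integral_cong[OF refl])
    fix \<omega> assume w: "\<omega> \<in> space \<Omega>"
    have "G (\<lambda>k. X k \<omega>) * h (X (Suc m) \<omega>) =
        (\<Sum>x\<in>S. G x * indicator (B x) \<omega>) * (\<Sum>j\<in>UNIV. h j * indicator {X (Suc m) \<omega>} j)"
      unfolding G_restrict split[OF w] by (simp add: indicator_def)
    also have "\<dots> = (\<Sum>x\<in>S. \<Sum>j\<in>UNIV. G x * h j * indicator (C x j) \<omega>)"
      unfolding sum_product by (intro sum.cong refl) (use w in \<open>auto simp: indicator_def B_def C_def\<close>)
    finally show "G (\<lambda>k. X k \<omega>) * h (X (Suc m) \<omega>) =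
      (\<Sum>x\<in>S. \<Sum>j\<in>UNIV. G x * h j * indicator (C x j) \<omega>)" .
  qed
  also have "\<dots> = (\<Sum>x\<in>S. \<Sum>j\<in>UNIV. G x * h j * measure \<Omega> (C x j))"
    by (subst Bochner_Integration.integral_sum; (intro sum.cong refl Bochner_Integration.integrable_sum)?;
        (subst Bochner_Integration.integral_sum)?; (simp add: emeasure_eq_measure)?)
  also have "\<dots> = (\<Sum>x\<in>S. (G x * measure_pmf.expectation (K (x m)) h) * measure \<Omega> (B x))"
    unfolding BC expectation_finite by (simp add: sum_distrib_left sum_distrib_right mult_ac)
  also have "\<dots> = (\<integral>\<omega>. (\<Sum>x\<in>S. (G x * measure_pmf.expectation (K (x m)) h) * indicator (B x) \<omega>) \<partial>\<Omega>)"
    by (subst Bochner_Integration.integral_sum) (simp_all add: emeasure_eq_measure)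
  also have "\<dots> = (\<integral>\<omega>. G (\<lambda>k. X k \<omega>) * measure_pmf.expectation (K (X m \<omega>)) h \<partial>\<Omega>)"
  proof (rule Bochner_Integration.integral_cong[OF refl])
    fix \<omega> assume w: "\<omega> \<in> space \<Omega>"
    show "(\<Sum>x\<in>S. (G x * measure_pmf.expectation (K (x m)) h) * indicator (B x) \<omega>) =
        G (\<lambda>k. X k \<omega>) * measure_pmf.expectation (K (X m \<omega>)) h"
      unfolding split[OF w, symmetric] G_restrict by simp
  qed
  finally show ?thesis .
qed

lemma markov_chain_integral_nstep:
  fixes X :: "nat \<Rightarrow> 'a \<Rightarrow> 'd::finite" and h :: "'d \<Rightarrow> real" and G :: "(nat \<Rightarrow> 'd) \<Rightarrow> real"
  assumes mc: "markov_chain \<Omega> K \<nu> X"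
    and past: "\<And>x y. (\<And>k. k \<le> m \<Longrightarrow> x k = y k) \<Longrightarrow> G x = G y"
  shows "(\<integral>\<omega>. G (\<lambda>k. X k \<omega>) * h (X (m + T) \<omega>) \<partial>\<Omega>) =
    (\<integral>\<omega>. G (\<lambda>k. X k \<omega>) * measure_pmf.expectation (nstep K T (X m \<omega>)) h \<partial>\<Omega>)"
proof (induction T arbitrary: h)
  case (Suc T)
  have "(\<integral>\<omega>. G (\<lambda>k. X k \<omega>) * h (X (Suc (m + T)) \<omega>) \<partial>\<Omega>) =
    (\<integral>\<omega>. G (\<lambda>k. X k \<omega>) * measure_pmf.expectation (K (X (m + T) \<omega>)) h \<partial>\<Omega>)"
    by (rule markov_chain_integral_step[OF mc]) (auto intro: past)
  also have "\<dots> = (\<integral>\<omega>. G (\<lambda>k. X k \<omega>) * measure_pmf.expectation (nstep K (Suc T) (X m \<omega>)) h \<partial>\<Omega>)"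
    by (subst Suc.IH[of "\<lambda>i. measure_pmf.expectation (K i) h"]) (simp add: expectation_bind_finite)
  finally show ?case by simp
qed simp

lemma markov_chain_integral_marginal:
  fixes X :: "nat \<Rightarrow> 'a \<Rightarrow> 'd::finite" and h :: "'d \<Rightarrow> real"
  assumes mc: "markov_chain \<Omega> K \<pi> X" and st: "stationary K \<pi>"
  shows "(\<integral>\<omega>. h (X n \<omega>) \<partial>\<Omega>) = measure_pmf.expectation \<pi> h"
proof -
  have X0: "X 0 \<in> measurable \<Omega> (count_space UNIV)"
    and distr: "distr \<Omega> (count_space UNIV) (X 0) = measure_pmf \<pi>"
    using mc by (simp_all add: markov_chain_def)
  have "(\<integral>\<omega>. h (X n \<omega>) \<partial>\<Omega>) = (\<integral>\<omega>. measure_pmf.expectation (nstep K n (X 0 \<omega>)) h \<partial>\<Omega>)"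
    using markov_chain_integral_nstep[OF mc, of 0 "\<lambda>_. 1" h n] by simp
  also have "\<dots> = measure_pmf.expectation \<pi> (\<lambda>i. measure_pmf.expectation (nstep K n i) h)"
    unfolding distr[symmetric] by (rule integral_distr[symmetric]) (use X0 in auto)
  finally show ?thesis by (simp add: stationary_expectation_nstep[OF st])
qed

text \<open>The path enters only through its restriction to \<open>{..m}\<close>, which takes
  finitely many values; hence the integrand is bounded and measurable.\<close>

lemma markov_chain_integrable:
  fixes X :: "nat \<Rightarrow> 'a \<Rightarrow> 'd::finite" and G :: "(nat \<Rightarrow> 'd) \<Rightarrow> real"
  assumes mc: "markov_chain \<Omega> K \<nu> X"
    and past: "\<And>x y. (\<And>k. k \<le> m \<Longrightarrow> x k = y k) \<Longrightarrow> G x = G y"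
  shows "integrable \<Omega> (\<lambda>\<omega>. G (\<lambda>k. X k \<omega>))"
proof -
  interpret prob_space \<Omega> using mc by (simp add: markov_chain_def)
  have X [measurable]: "X n \<in> measurable \<Omega> (count_space UNIV)" for n
    using mc by (simp add: markov_chain_def)
  let ?R = "\<lambda>\<omega>. restrict (\<lambda>k. X k \<omega>) {..m}"
  let ?S = "{..m} \<rightarrow>\<^sub>E (UNIV :: 'd set)"
  have fin: "finite ?S" by (intro finite_PiE) auto
  have R: "?R \<in> measurable \<Omega> (count_space ?S)"
  proof (rule measurable_count_space_eq2[OF fin, THEN iffD2], intro conjI ballI)
    fix x assume x: "x \<in> ?S"
    have "?R -` {x} \<inter> space \<Omega> = {\<omega>\<in>space \<Omega>. \<forall>k\<in>{..m}. X k \<omega> = x k}"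
      using x by (auto simp: fun_eq_iff PiE_def extensional_def restrict_def)
    also have "\<dots> \<in> sets \<Omega>" by measurable
    finally show "?R -` {x} \<inter> space \<Omega> \<in> sets \<Omega>" .
  qed auto
  have eq: "G (\<lambda>k. X k \<omega>) = G (?R \<omega>)" for \<omega> by (rule past) auto
  show ?thesis unfolding eq
  proof (rule integrable_const_bound[where B = "\<Sum>x\<in>?S. \<bar>G x\<bar>"])
    show "AE \<omega> in \<Omega>. norm (G (?R \<omega>)) \<le> (\<Sum>x\<in>?S. \<bar>G x\<bar>)"
      by (intro AE_I2, unfold real_norm_def, rule member_le_sum[of _ ?S "\<lambda>x. \<bar>G x\<bar>"])
        (simp_all add: fin restrict_PiE_iff)
    show "(\<lambda>\<omega>. G (?R \<omega>)) \<in> borel_measurable \<Omega>"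
      by (rule measurable_compose[OF R]) simp
  qed
qed

section \<open>Concentration of the empirical mean\<close>

text \<open>Centring at an upper bound \<open>c\<close> of the mean instead of the mean itself is
  harmless for \<open>\<theta> > 0\<close>. It is what allows one bound to serve all states from
  which the last \<open>T\<close> steps may start.\<close>

lemma Hoeffding_lemma_pmf:
  fixes p :: "'d::finite pmf" and g :: "'d \<Rightarrow> real"
  assumes "\<And>i. g i \<in> {a..a + 1}" and "measure_pmf.expectation p g \<le> c" and "0 < \<theta>"
  shows "measure_pmf.expectation p (\<lambda>i. exp (\<theta> * (g i - c))) \<le> exp (\<theta>\<^sup>2 / 8)"
proof -
  interpret interval_bounded_random_variable "measure_pmf p" g a "a + 1"
    by unfold_locales (use assms in auto)
  let ?e = "measure_pmf.expectation p g"
  have "measure_pmf.expectation p (\<lambda>i. exp (\<theta> * (g i - c)))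
      \<le> measure_pmf.expectation p (\<lambda>i. exp (\<theta> * (g i - ?e)))"
    using assms by (intro expectation_mono_finite) auto
  also have "\<dots> \<le> exp (\<theta>\<^sup>2 / 8)"
  proof -
    have "ennreal (measure_pmf.expectation p (\<lambda>i. exp (\<theta> * (g i - ?e)))) \<le> ennreal (exp (\<theta>\<^sup>2 / 8))"
      using Hoeffdings_lemma_nn_integral[OF assms(3)]
      by (subst nn_integral_eq_integral[symmetric]) (auto intro!: integrable_measure_pmf_finite)
    thus ?thesis by simp
  qed
  finally show ?thesis .
qed

text \<open>Conditioning on the past of the last but one factor replaces the last factor by its mean
  after \<open>T\<close> steps, at most \<open>C\<close>, and induction removes the factors one by
  one. The functions \<open>\<phi> n\<close> vary with time so that padded positions can carry the
  constant 1.\<close>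

lemma markov_chain_block_bound:
  fixes X :: "nat \<Rightarrow> 'a \<Rightarrow> 'd::finite" and \<phi> :: "nat \<Rightarrow> 'd \<Rightarrow> real"
  assumes mc: "markov_chain \<Omega> K \<pi> X" and st: "stationary K \<pi>"
    and nonneg: "\<And>n i. 0 \<le> \<phi> n i"
    and bound: "\<And>n i. measure_pmf.expectation (nstep K T i) (\<phi> n) \<le> C"
  shows "(\<integral>\<omega>. (\<Prod>j<q. \<phi> (k + j * T) (X (k + j * T) \<omega>)) \<partial>\<Omega>) \<le> C ^ q"
proof (induction q)
  case 0
  interpret prob_space \<Omega> using mc by (simp add: markov_chain_def)
  show ?case by (simp add: prob_space)
next
  case (Suc q)
  have C: "0 \<le> C"
    using bound expectation_ge_const[of 0 "\<phi> 0"] nonneg order_trans by blast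
  show ?case
  proof (cases q)
    \<comment> \<open>The only remaining factor sits at time \<open>k\<close>, possibly less than
      \<open>T\<close>, so no earlier sample is available \<open>T\<close> steps back. By
      stationarity its law \<open>\<pi>\<close> is also the law after \<open>T\<close> steps from
      \<open>\<pi>\<close>, so \<open>bound\<close> still applies.\<close>
    case 0
    have "(\<integral>\<omega>. \<phi> k (X k \<omega>) \<partial>\<Omega>) =
        measure_pmf.expectation \<pi> (\<lambda>i. measure_pmf.expectation (nstep K T i) (\<phi> k))"
      by (simp add: markov_chain_integral_marginal[OF mc st] stationary_expectation_nstep[OF st])
    also have "\<dots> \<le> C" by (rule expectation_le_const) (rule bound)
    finally show ?thesis by (simp add: 0)
  next
    case (Suc q')
    define m where "m = k + q' * T"
    define G where "G x = (\<Prod>j<q. \<phi> (k + j * T) (x (k + j * T)))" for x :: "nat \<Rightarrow> 'd"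
    have past: "G x = G y" if "\<And>l. l \<le> m \<Longrightarrow> x l = y l" for x y
      unfolding G_def by (intro prod.cong refl) (auto simp: m_def Suc intro!: that arg_cong[of _ _ "\<phi> _"])
    have G0: "0 \<le> G x" for x
      unfolding G_def by (intro prod_nonneg) (simp add: nonneg)
    let ?P = "\<lambda>i. measure_pmf.expectation (nstep K T i) (\<phi> (m + T))"
    have "(\<integral>\<omega>. (\<Prod>j<Suc q. \<phi> (k + j * T) (X (k + j * T) \<omega>)) \<partial>\<Omega>) =
        (\<integral>\<omega>. G (\<lambda>k. X k \<omega>) * \<phi> (m + T) (X (m + T) \<omega>) \<partial>\<Omega>)"
      by (simp add: G_def m_def Suc algebra_simps)
    also have "\<dots> = (\<integral>\<omega>. G (\<lambda>k. X k \<omega>) * ?P (X m \<omega>) \<partial>\<Omega>)"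
      by (rule markov_chain_integral_nstep[OF mc past])
    also have "\<dots> \<le> (\<integral>\<omega>. G (\<lambda>k. X k \<omega>) * C \<partial>\<Omega>)"
    proof (rule integral_mono)
      show "integrable \<Omega> (\<lambda>\<omega>. G (\<lambda>k. X k \<omega>) * ?P (X m \<omega>))"
        by (rule markov_chain_integrable[OF mc, of m "\<lambda>x. G x * ?P (x m)"])
          (use past in \<open>metis order_refl\<close>)
      show "integrable \<Omega> (\<lambda>\<omega>. G (\<lambda>k. X k \<omega>) * C)"
        by (rule markov_chain_integrable[OF mc, of m "\<lambda>x. G x * C"]) (use past in metis)
    qed (intro mult_left_mono bound G0)
    also have "\<dots> \<le> C ^ q * C"
      using Suc.IH C by (simp add: G_def mult_right_mono)
    finally show ?thesis by (simp add: mult.commute)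
  qed
qed

lemma markov_chain_mean_tail:
  fixes X :: "nat \<Rightarrow> 'a \<Rightarrow> 'd::finite" and g :: "'d \<Rightarrow> real"
  assumes mc: "markov_chain \<Omega> K \<pi> X" and st: "stationary K \<pi>"
    and range: "\<And>i. g i \<in> {a..a + 1}"
    and mean: "\<And>i. measure_pmf.expectation (nstep K T i) g \<le> c"
    and T: "1 \<le> T" "T \<le> N" and \<epsilon>: "0 \<le> \<epsilon>"
  shows "\<P>(\<omega> in \<Omega>. c + \<epsilon> \<le> emp_mean g N (\<lambda>n. X n \<omega>)) \<le> exp (- real N * \<epsilon>\<^sup>2 / real T)"
proof (cases "\<epsilon> = 0")
  case True
  interpret prob_space \<Omega> using mc by (simp add: markov_chain_def)
  show ?thesis using True by simp
next
  case False
  with \<epsilon> have \<epsilon>: "0 < \<epsilon>" by simp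
  interpret prob_space \<Omega> using mc by (simp add: markov_chain_def)
  have X [measurable]: "X n \<in> measurable \<Omega> (count_space UNIV)" for n
    using mc by (simp add: markov_chain_def)
  \<comment> \<open>This choice minimises \<open>N * \<theta>\<^sup>2 / (4 * T) - \<theta> * N *
    \<epsilon> / T\<close>, the exponent left after \<open>q\<close> is bounded by
    \<open>2 * N / T\<close>.\<close>
  define \<theta> where "\<theta> = 2 * \<epsilon>"
  define t where "t = \<theta> / T"
  define q where "q = N div T + 1"
  \<comment> \<open>Padding by zeros makes all \<open>T\<close> progressions equally long.\<close>
  define F where "F n i = (if n \<in> {1..N} then g i - c else 0)" for n i
  define Y where "Y l \<omega> = exp (\<theta> * (\<Sum>j<q. F (Suc l + j * T) (X (Suc l + j * T) \<omega>)))" for l \<omega>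
  define Z where "Z \<omega> = exp (t * (\<Sum>n=1..N. g (X n \<omega>) - c))" for \<omega>
  have \<theta>: "0 < \<theta>" and t: "0 < t" using \<epsilon> T by (auto simp: \<theta>_def t_def)
  have N: "N < q * T" unfolding q_def using dividend_less_div_times[of T N] T by (simp add: algebra_simps)
  \<comment> \<open>Here \<open>T \<le> N\<close> enters: the padding adds at most \<open>T\<close>
    positions, hence at most \<open>N\<close>.\<close>
  have qT: "q * T \<le> 2 * N" unfolding q_def using T add_mono[OF T(2) times_div_less_eq_dividend[of T N]] by (simp add: algebra_simps)

  have Y_bound: "(\<integral>\<omega>. Y l \<omega> \<partial>\<Omega>) \<le> exp (\<theta>\<^sup>2 / 8) ^ q" for l
    unfolding Y_def sum_distrib_left exp_sum[OF finite_lessThan]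
  proof (rule markov_chain_block_bound[OF mc st, where \<phi> = "\<lambda>n i. exp (\<theta> * F n i)"])
    fix n i
    show "measure_pmf.expectation (nstep K T i) (\<lambda>i. exp (\<theta> * F n i)) \<le> exp (\<theta>\<^sup>2 / 8)"
      using Hoeffding_lemma_pmf[OF range mean \<theta>] by (cases "n \<in> {1..N}") (simp_all add: F_def del: atLeastAtMost_iff)
  qed simp
  have int_Y: "integrable \<Omega> (Y l)" for l
    unfolding Y_def
    by (rule markov_chain_integrable[OF mc, of "Suc l + q * T" "\<lambda>x. exp (\<theta> * (\<Sum>j<q. F (Suc l + j * T) (x (Suc l + j * T))))"])
      (auto intro!: arg_cong[of _ _ "F _"] sum.cong)
  have int_Z: "integrable \<Omega> Z"
    unfolding Z_def
    by (rule markov_chain_integrable[OF mc, of N "\<lambda>x. exp (t * (\<Sum>n=1..N. g (x n) - c))"])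
      (auto intro!: arg_cong[of _ _ g] sum.cong)

  \<comment> \<open>Writing \<open>n = Suc l + j * T\<close> sorts the samples by residue. As
    \<open>t = \<theta> / T\<close>, the exponent of \<open>Z\<close> is the average of the
    \<open>T\<close> exponents in \<open>Y l\<close>, so Jensen's inequality applies and no
    independence between the progressions is required.\<close>
  have Z_le: "Z \<omega> \<le> (\<Sum>l<T. (1 / T) * Y l \<omega>)" for \<omega>
  proof -
    have "(\<Sum>n=1..N. g (X n \<omega>) - c) = (\<Sum>n\<in>{1..q * T}. F n (X n \<omega>))"
      unfolding F_def using N by (intro sum.mono_neutral_cong_left) auto
    also have "\<dots> = (\<Sum>n<q * T. F (Suc n) (X (Suc n) \<omega>))"
      by (simp add: sum.atLeast1_atMost_eq)
    also have "\<dots> = (\<Sum>j<q. \<Sum>l<T. F (Suc l + j * T) (X (Suc l + j * T) \<omega>))"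
      by (simp add: sum_mult_product)
    also have "\<dots> = (\<Sum>l<T. \<Sum>j<q. F (Suc l + j * T) (X (Suc l + j * T) \<omega>))"
      by (rule sum.swap)
    finally have "Z \<omega> = exp (\<Sum>l<T. (1 / T) *\<^sub>R (\<theta> * (\<Sum>j<q. F (Suc l + j * T) (X (Suc l + j * T) \<omega>))))"
      by (simp add: Z_def t_def sum_distrib_left)
    also have "\<dots> \<le> (\<Sum>l<T. (1 / T) * Y l \<omega>)"
      unfolding Y_def
      by (rule convex_on_sum[OF _ _ convex_on_exp[of 1, simplified]]) (use T in \<open>auto simp: lessThan_empty_iff\<close>)
    finally show ?thesis .
  qed
  have "expectation Z \<le> expectation (\<lambda>\<omega>. \<Sum>l<T. (1 / T) * Y l \<omega>)"
    by (intro integral_mono int_Z Z_le Bochner_Integration.integrable_sum integrable_mult_right int_Y)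
  also have "\<dots> = (\<Sum>l<T. (1 / T) * expectation (Y l))"
    by (simp add: int_Y)
  also have "\<dots> \<le> (\<Sum>l<T. (1 / T) * exp (\<theta>\<^sup>2 / 8) ^ q)"
    by (intro sum_mono mult_left_mono Y_bound) auto
  also have "\<dots> = exp (q * \<theta>\<^sup>2 / 8)"
    using T by (simp flip: exp_of_nat_mult)
  also have "\<dots> \<le> exp (real (2 * N) / T * \<theta>\<^sup>2 / 8)"
  proof -
    have "real q \<le> real (2 * N) / T"
      using qT T by (simp add: field_simps flip: of_nat_mult)
    hence "real q * \<theta>\<^sup>2 / 8 \<le> real (2 * N) / T * \<theta>\<^sup>2 / 8" by (intro divide_right_mono mult_right_mono) auto
    thus ?thesis by simp
  qed
  finally have EZ: "expectation Z \<le> exp (N * \<epsilon>\<^sup>2 / T)"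
    by (simp add: \<theta>_def power_mult_distrib)

  have "\<P>(\<omega> in \<Omega>. c + \<epsilon> \<le> emp_mean g N (\<lambda>n. X n \<omega>)) \<le> \<P>(\<omega> in \<Omega>. exp (t * (N * \<epsilon>)) \<le> Z \<omega>)"
  proof (rule finite_measure_mono)
    show "{\<omega> \<in> space \<Omega>. c + \<epsilon> \<le> emp_mean g N (\<lambda>n. X n \<omega>)} \<subseteq> {\<omega> \<in> space \<Omega>. exp (t * (N * \<epsilon>)) \<le> Z \<omega>}"
    proof
      fix \<omega> assume w: "\<omega> \<in> {\<omega> \<in> space \<Omega>. c + \<epsilon> \<le> emp_mean g N (\<lambda>n. X n \<omega>)}"
      hence "N * \<epsilon> \<le> (\<Sum>n=1..N. g (X n \<omega>) - c)"
        using T by (simp add: emp_mean_def sum_subtractf field_simps)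
      with w t show "\<omega> \<in> {\<omega> \<in> space \<Omega>. exp (t * (N * \<epsilon>)) \<le> Z \<omega>}"
        by (simp add: Z_def)
    qed
    show "{\<omega> \<in> space \<Omega>. exp (t * (N * \<epsilon>)) \<le> Z \<omega>} \<in> events"
      using borel_measurable_integrable[OF int_Z] by measurable
  qed
  also have "\<dots> \<le> expectation Z / exp (t * (N * \<epsilon>))"
    by (rule integral_Markov_inequality_measure[OF int_Z, where A = "{}"]) (auto simp: Z_def)
  also have "\<dots> \<le> exp (N * \<epsilon>\<^sup>2 / T) / exp (t * (N * \<epsilon>))"
    by (intro divide_right_mono EZ) auto
  also have "\<dots> = exp (- real N * \<epsilon>\<^sup>2 / real T)"
    by (simp add: t_def \<theta>_def power2_eq_square mult_ac flip: exp_diff)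
  finally show ?thesis .
qed

section \<open>Finiteness of the mixing time\<close>

lemma nstep_add: "nstep K (m + n) i = bind_pmf (nstep K m i) (nstep K n)"
proof (induction n)
  case 0
  show ?case by (simp add: nstep_0_fun bind_return_pmf')
next
  case (Suc n)
  thus ?case by (simp add: nstep_Suc_fun bind_assoc_pmf)
qed

lemma set_pmf_nstep_trans:
  assumes "j \<in> set_pmf (nstep K m i)" and "l \<in> set_pmf (nstep K n j)"
  shows "l \<in> set_pmf (nstep K (m + n) i)"
  using assms by (auto simp: nstep_add)

text \<open>After a path of length \<open>l\<close> from \<open>i\<close> to \<open>j\<close>, every
  large surplus of time can be spent at \<open>j\<close>: an even one by two-step returns, an odd
  one by a single odd loop followed by two-step returns.\<close>

lemma set_pmf_nstep_eventually:
  fixes K :: "'d::finite \<Rightarrow> 'd pmf"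
  assumes irr: "irreducible_kernel K" and aper: "aperiodic_kernel K"
    and st: "stationary K \<pi>" and rev: "reversible K \<pi>"
  shows "eventually (\<lambda>m. j \<in> set_pmf (nstep K m i)) sequentially"
proof -
  have irr': "\<exists>n. j \<in> set_pmf (nstep K n i)" for i j
    using irr unfolding irreducible_kernel_def by (metis pmf_positive_iff)
  \<comment> \<open>Detailed balance transfers positivity from a transition to its reverse only
    where \<open>\<pi>\<close> has mass, hence full support is established before the two-step
    returns.\<close>
  have full: "i \<in> set_pmf \<pi>" for i
  proof -
    obtain j where j: "j \<in> set_pmf \<pi>" using set_pmf_not_empty[of \<pi>] by auto
    obtain n where n: "i \<in> set_pmf (nstep K n j)" using irr' by blast
    have "i \<in> set_pmf (bind_pmf \<pi> (nstep K n))" using j n by auto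
    thus ?thesis by (simp add: stationary_nstep[OF st])
  qed
  have two: "i \<in> set_pmf (nstep K 2 i)" for i
  proof -
    obtain j where j: "j \<in> set_pmf (K i)" using set_pmf_not_empty[of "K i"] by auto
    have "pmf \<pi> j * pmf (K j) i = pmf \<pi> i * pmf (K i) j"
      using rev by (simp add: reversible_def)
    also have "\<dots> > 0" using full j by (simp add: pmf_positive_iff)
    finally have "i \<in> set_pmf (K j)" by (simp add: zero_less_mult_iff pmf_positive_iff)
    with j show ?thesis by (auto simp: numeral_2_eq_2 bind_return_pmf)
  qed
  have even: "i \<in> set_pmf (nstep K (2 * k) i)" for i k
  proof (induction k)
    case (Suc k)
    show ?case using set_pmf_nstep_trans[OF two Suc] by simp
  qed simp
  have "\<exists>n. odd n \<and> i \<in> set_pmf (nstep K n i)" for i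
  proof (rule ccontr)
    assume "\<not> ?thesis"
    hence "2 dvd Gcd {n. n \<ge> 1 \<and> pmf (nstep K n i) i > 0}"
      by (intro Gcd_greatest) (auto simp: pmf_positive_iff)
    thus False using aper by (simp add: aperiodic_kernel_def)
  qed
  then obtain n where n: "odd n" "j \<in> set_pmf (nstep K n j)" by blast
  obtain l where l: "j \<in> set_pmf (nstep K l i)" using irr' by blast
  have "j \<in> set_pmf (nstep K m i)" if m: "l + n \<le> m" for m
  proof -
    have "j \<in> set_pmf (nstep K (m - l) j)"
    proof (cases "even (m - l)")
      case True
      thus ?thesis using even[of j "(m - l) div 2"] by simp
    next
      case False
      hence "even (m - l - n)" using n m by simp
      hence "n + 2 * ((m - l - n) div 2) = m - l" using m by simp
      thus ?thesis using set_pmf_nstep_trans[OF n(2) even] by metis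
    qed
    from set_pmf_nstep_trans[OF l this] m show ?thesis by simp
  qed
  thus ?thesis by (auto simp: eventually_sequentially)
qed

text \<open>Mass \<open>c\<close> is placed at \<open>j\<close> and the remaining
  \<open>1 - c\<close> averages values in \<open>[a, b]\<close>. The resulting interval depends on
  \<open>c\<close> and \<open>j\<close> but not on \<open>p\<close>, so it is common to all starting
  states, and it is shorter by the factor \<open>1 - c\<close>.\<close>

lemma doeblin_contraction:
  fixes p :: "'d::finite pmf" and h :: "'d \<Rightarrow> real"
  assumes "\<And>i. h i \<in> {a..b}" and "c \<le> pmf p j"
  shows "measure_pmf.expectation p h \<in> {c * h j + (1 - c) * a..c * h j + (1 - c) * b}"
proof -
  have split: "measure_pmf.expectation p g = pmf p j * g j + (\<Sum>i\<in>UNIV - {j}. pmf p i * g i)"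
    for g :: "'d \<Rightarrow> real"
    unfolding expectation_finite by (simp add: sum.remove[of UNIV j])
  have rest: "(\<Sum>i\<in>UNIV - {j}. pmf p i) = 1 - pmf p j"
    using split[of "\<lambda>_. 1"] by simp
  have "(\<Sum>i\<in>UNIV - {j}. pmf p i * h i) \<in> {(1 - pmf p j) * a..(1 - pmf p j) * b}"
    unfolding rest[symmetric] sum_distrib_right using assms(1) by (auto intro!: sum_mono mult_left_mono)
  moreover have "(pmf p j - c) * a \<le> (pmf p j - c) * h j" "(pmf p j - c) * h j \<le> (pmf p j - c) * b"
    using assms by (auto intro!: mult_left_mono)
  ultimately show ?thesis unfolding split[of h] by (auto simp: algebra_simps)
qed

text \<open>Without a witness the \<open>LEAST\<close> in the mixing time would say nothing. The
  witness comes from Doeblin's argument: the interval containing the means from all starting states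
  shrinks geometrically, and it always contains the stationary mean, which is an average of
  them.\<close>

lemma f_mixing_time_exists:
  fixes K :: "'d::finite \<Rightarrow> 'd pmf"
  assumes irr: "irreducible_kernel K" and aper: "aperiodic_kernel K"
    and st: "stationary K \<pi>" and rev: "reversible K \<pi>"
    and f: "\<And>i. f i \<in> {0..1}" and \<delta>: "0 < \<delta>"
  shows "\<exists>n\<ge>1. (MAX i\<in>UNIV. f_dist f (nstep K n i) \<pi>) \<le> \<delta>"
proof -
  obtain j :: 'd where True by blast
  have "eventually (\<lambda>m. \<forall>i. j \<in> set_pmf (nstep K m i)) sequentially"
    using set_pmf_nstep_eventually[OF irr aper st rev] by (simp add: eventually_all_finite)
  from eventually_conj[OF this eventually_ge_at_top[of 1]]
  obtain m where m: "\<And>i. j \<in> set_pmf (nstep K m i)" "1 \<le> m"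
    using eventually_happens'[OF sequentially_bot] by blast
  define c where "c = (MIN i\<in>UNIV. pmf (nstep K m i) j)"
  have c_le: "c \<le> pmf (nstep K m i) j" for i unfolding c_def by (intro Min_le) auto
  have c_pos: "0 < c" using m by (simp add: c_def pmf_positive_iff)
  have c_1: "c \<le> 1" by (rule order_trans[OF c_le[of j] pmf_le_1])
  have contract: "\<exists>a b. b - a = (1 - c) ^ k \<and> (\<forall>i. measure_pmf.expectation (nstep K (k * m) i) f \<in> {a..b})" for k
  proof (induction k)
    case 0
    show ?case using f by (intro exI[of _ 0] exI[of _ 1]) simp
  next
    case (Suc k)
    then obtain a b where ab: "b - a = (1 - c) ^ k"
      "\<And>i. measure_pmf.expectation (nstep K (k * m) i) f \<in> {a..b}" by blast
    let ?h = "\<lambda>i. measure_pmf.expectation (nstep K (k * m) i) f"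
    have "measure_pmf.expectation (nstep K (Suc k * m) i) f \<in>
        {c * ?h j + (1 - c) * a..c * ?h j + (1 - c) * b}" for i
      using doeblin_contraction[of ?h a b, OF ab(2) c_le] by (simp add: nstep_add expectation_bind_finite)
    moreover have "(c * ?h j + (1 - c) * b) - (c * ?h j + (1 - c) * a) = (1 - c) ^ Suc k"
      using ab(1) by (simp add: algebra_simps)
    ultimately show ?case by blast
  qed
  obtain k where k: "(1 - c) ^ k < \<delta>" using real_arch_pow_inv[OF \<delta>, of "1 - c"] c_pos by auto
  \<comment> \<open>One contraction more than necessary keeps the witness \<open>Suc k * m\<close>
    at least 1 even if \<open>k = 0\<close>.\<close>
  have "(1 - c) ^ Suc k \<le> (1 - c) ^ k" using c_pos c_1 by (simp add: mult_left_le_one_le)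
  with k have k': "(1 - c) ^ Suc k \<le> \<delta>" by simp
  obtain a b where ab: "b - a = (1 - c) ^ Suc k"
    "\<And>i. measure_pmf.expectation (nstep K (Suc k * m) i) f \<in> {a..b}" using contract by blast
  have "measure_pmf.expectation \<pi> f \<in> {a..b}"
    using ab(2) expectation_le_const[of "\<lambda>i. measure_pmf.expectation (nstep K (Suc k * m) i) f" b \<pi>]
      expectation_ge_const[of a "\<lambda>i. measure_pmf.expectation (nstep K (Suc k * m) i) f" \<pi>]
    unfolding stationary_expectation_nstep[OF st] by auto
  hence "f_dist f (nstep K (Suc k * m) i) \<pi> \<le> \<delta>" for i
    using ab(2)[of i] ab(1) k' unfolding f_dist_def by auto
  hence "(MAX i\<in>UNIV. f_dist f (nstep K (Suc k * m) i) \<pi>) \<le> \<delta>" by simp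
  moreover have "1 \<le> Suc k * m" using m by simp
  ultimately show ?thesis by blast
qed

lemma f_mixing_time:
  fixes K :: "'d::finite \<Rightarrow> 'd pmf"
  assumes "irreducible_kernel K" and "aperiodic_kernel K"
    and "stationary K \<pi>" and "reversible K \<pi>"
    and "\<And>i. f i \<in> {0..1}" and "0 < \<delta>"
  shows "1 \<le> f_mixing_time K \<pi> f \<delta>"
    and "f_dist f (nstep K (f_mixing_time K \<pi> f \<delta>) i) \<pi> \<le> \<delta>"
  using LeastI_ex[OF f_mixing_time_exists[OF assms]] unfolding f_mixing_time_def by auto

text \<open>The sign \<open>s\<close> lets both kinds of error share one estimate:
  \<open>s * (f i - \<mu>)\<close> ranges over an interval of length one for either sign, and its
  mean after \<open>T\<close> steps is at most \<open>\<delta>\<close>.\<close>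

lemma f_mixing_time_tail:
  fixes X :: "nat \<Rightarrow> 'a \<Rightarrow> 'd::finite" and s :: real
  assumes mc: "markov_chain \<Omega> K \<pi> X"
    and erg: "irreducible_kernel K" "aperiodic_kernel K" "stationary K \<pi>" "reversible K \<pi>"
    and f: "\<And>i. f i \<in> {0..1}"
    and s: "s = 1 \<or> s = -1" and \<delta>: "0 < \<delta>" and \<epsilon>: "0 \<le> \<epsilon>"
    and N: "f_mixing_time K \<pi> f \<delta> \<le> N"
  shows "\<P>(\<omega> in \<Omega>. \<delta> + \<epsilon> \<le> s * (emp_mean f N (\<lambda>n. X n \<omega>) - measure_pmf.expectation \<pi> f))
    \<le> exp (- real N * \<epsilon>\<^sup>2 / real (f_mixing_time K \<pi> f \<delta>))"
proof -
  let ?\<mu> = "measure_pmf.expectation \<pi> f"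
  let ?T = "f_mixing_time K \<pi> f \<delta>"
  define g where "g i = s * (f i - ?\<mu>)" for i
  note T = f_mixing_time[where f = f, OF erg f \<delta>]
  have mean_g: "emp_mean g N x = s * (emp_mean f N x - ?\<mu>)" for x
    using T(1) N by (simp add: emp_mean_def g_def sum_subtractf field_simps flip: sum_distrib_left)
  have "\<exists>a. \<forall>i. g i \<in> {a..a + 1}"
    using s f by (intro exI[of _ "if s = 1 then - ?\<mu> else ?\<mu> - 1"]) (auto simp: g_def)
  then obtain a where a: "\<And>i. g i \<in> {a..a + 1}" by blast
  have "measure_pmf.expectation (nstep K ?T i) g \<le> \<delta>" for i
  proof -
    have "measure_pmf.expectation (nstep K ?T i) g = s * (measure_pmf.expectation (nstep K ?T i) f - ?\<mu>)"
      unfolding g_def by (simp add: integrable_measure_pmf_finite)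
    thus ?thesis using T(2)[of i] s by (auto simp: f_dist_def)
  qed
  from markov_chain_mean_tail[OF mc erg(3) a this T(1) N \<epsilon>]
  show ?thesis unfolding mean_g .
qed

section \<open>Error probabilities of the tests\<close>

lemma emp_mean_measurable:
  fixes f :: "'d::finite \<Rightarrow> real"
  assumes "markov_chain \<Omega> K \<nu> X"
  shows "(\<lambda>\<omega>. emp_mean f N (\<lambda>n. X n \<omega>)) \<in> borel_measurable \<Omega>"
proof -
  have [measurable]: "X n \<in> measurable \<Omega> (count_space UNIV)" for n
    using assms by (simp add: markov_chain_def)
  show ?thesis unfolding emp_mean_def by measurable
qed

lemma emp_mean_in_unit_interval:
  assumes f: "\<And>i. f i \<in> {0..1}"
  shows "emp_mean f N x \<in> {0..1}"
proof -
  have "(\<Sum>n=1..N. f (x n)) \<le> real N"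
    using f sum_mono[of "{1..N}" "\<lambda>n. f (x n)" "\<lambda>_. 1"] by simp
  moreover have "0 \<le> (\<Sum>n=1..N. f (x n))" using f by (simp add: sum_nonneg)
  ultimately show ?thesis by (auto simp: emp_mean_def divide_le_eq)
qed

lemma test_err_le:
  assumes "0 \<le> \<alpha>"
    and "measure_pmf.expectation \<pi> f \<le> r - \<delta> \<Longrightarrow> \<P>(\<omega> in \<Omega>. A (\<lambda>n. X n \<omega>) = H0) \<le> \<alpha>"
    and "r + \<delta> \<le> measure_pmf.expectation \<pi> f \<Longrightarrow> \<P>(\<omega> in \<Omega>. A (\<lambda>n. X n \<omega>) = H1) \<le> \<alpha>"
  shows "test_err \<Omega> X \<pi> f r \<delta> A \<le> \<alpha>"
  using assms by (auto simp: test_err_def Let_def)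

lemma fixed_test_err:
  fixes X :: "nat \<Rightarrow> 'a \<Rightarrow> 'd::finite"
  assumes mc: "markov_chain \<Omega> K \<pi> X"
    and erg: "irreducible_kernel K" "aperiodic_kernel K" "stationary K \<pi>" "reversible K \<pi>"
    and f: "\<And>i. f i \<in> {0..1}"
    and \<alpha>: "0 < \<alpha>" "\<alpha> \<le> 2 / 5" and \<delta>: "0 < \<delta>" "\<delta> \<le> 1"
  shows "test_err \<Omega> X \<pi> f r \<delta> (A_fixed f r \<delta> (N_fixed K \<pi> f \<alpha> \<delta>)) \<le> \<alpha>"
proof -
  interpret prob_space \<Omega> using mc by (simp add: markov_chain_def)
  note [measurable] = emp_mean_measurable[OF mc]
  let ?\<mu> = "measure_pmf.expectation \<pi> f"
  let ?T = "f_mixing_time K \<pi> f \<delta>"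
  define N where "N = N_fixed K \<pi> f \<alpha> \<delta>"
  \<comment> \<open>The bound \<open>\<alpha> \<le> 2 / 5\<close> serves to give
    \<open>ln (1 / \<alpha>) \<ge> 1 / 2\<close>, which together with
    \<open>\<delta> \<le> 1\<close> makes the prescribed sample size at least
    \<open>T\<close>.\<close>
  have "exp (1 / 2 :: real) \<le> 1 / \<alpha>"
  proof -
    have "exp (1 / 2 :: real) \<le> 1 + 1 / 2 + (1 / 2)\<^sup>2" by (rule exp_bound) auto
    also have "\<dots> \<le> 5 / 2" by (simp add: power2_eq_square)
    also have "\<dots> \<le> 1 / \<alpha>" using \<alpha> by (simp add: field_simps)
    finally show ?thesis .
  qed
  hence ln: "1 / 2 \<le> ln (1 / \<alpha>)" using \<alpha> by (subst ln_ge_iff) auto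
  have NT: "2 * ?T * ln (1 / \<alpha>) \<le> N * \<delta>\<^sup>2"
  proof -
    have "2 * ?T * ln (1 / \<alpha>) / \<delta>\<^sup>2 \<le> N"
      unfolding N_def N_fixed_def of_nat_mult of_nat_numeral by (rule real_nat_ceiling_ge)
    thus ?thesis using \<delta> by (simp add: field_simps)
  qed
  have "real ?T \<le> 2 * ?T * ln (1 / \<alpha>)"
    using mult_left_mono[OF ln, of "2 * real ?T"] by simp
  also have "\<dots> \<le> N * \<delta>\<^sup>2" by (rule NT)
  also have "\<dots> \<le> real N * 1" using \<delta> by (intro mult_left_mono power_le_one) auto
  finally have TN: "?T \<le> N" by simp
  have T1: "1 \<le> ?T" by (rule f_mixing_time(1)[OF erg f \<delta>(1)])
  have "exp (- real N * \<delta>\<^sup>2 / ?T) \<le> exp (- (2 * ln (1 / \<alpha>)))"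
    using NT T1 by (simp add: field_simps)
  also have "\<dots> \<le> exp (- ln (1 / \<alpha>))" using ln by simp
  also have "\<dots> = \<alpha>" using \<alpha> by (simp add: ln_div)
  \<comment> \<open>A wrong decision is a deviation of at least \<open>2 * \<delta>\<close> from the
    mean: one \<open>\<delta>\<close> covers the bias, the other is the fluctuation.\<close>
  finally have tail: "\<P>(\<omega> in \<Omega>. \<delta> + \<delta> \<le> s * (emp_mean f N (\<lambda>n. X n \<omega>) - ?\<mu>)) \<le> \<alpha>"
    if "s = 1 \<or> s = -1" for s
    using f_mixing_time_tail[OF mc erg f that \<delta>(1) less_imp_le[OF \<delta>(1)] TN] by (rule order_trans[rotated])
  show ?thesis unfolding N_def[symmetric]
  proof (rule test_err_le)
    assume \<mu>: "?\<mu> \<le> r - \<delta>"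
    show "\<P>(\<omega> in \<Omega>. A_fixed f r \<delta> N (\<lambda>n. X n \<omega>) = H0) \<le> \<alpha>"
      by (rule order_trans[OF finite_measure_mono tail[of 1]])
        (use \<mu> in \<open>auto simp: A_fixed_def split: if_splits\<close>)
  next
    assume \<mu>: "r + \<delta> \<le> ?\<mu>"
    show "\<P>(\<omega> in \<Omega>. A_fixed f r \<delta> N (\<lambda>n. X n \<omega>) = H1) \<le> \<alpha>"
      by (rule order_trans[OF finite_measure_mono tail[of "-1"]])
        (use \<mu> in \<open>auto simp: A_fixed_def split: if_splits\<close>)
  qed (use \<alpha> in simp)
qed

section \<open>Reduction of sequential errors to a union bound\<close>

text \<open>Minimality of the stopping index is discarded on purpose: the mere existence of a
  crossing is a union of events at deterministic times.\<close>

lemma sequential_test_H0D: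
  assumes "sequential_test f r N \<epsilon> x = H0"
  shows "\<exists>k\<ge>1. \<epsilon> k \<le> ereal (emp_mean f (N k) x - r)"
proof -
  let ?P = "\<lambda>k. k \<ge> 1 \<and> stops_at f r N \<epsilon> x k"
  let ?k = "LEAST k. ?P k"
  have ex: "\<exists>k. ?P k" and "ereal r + \<epsilon> ?k \<le> ereal (emp_mean f (N ?k) x)"
    using assms by (auto simp: sequential_test_def Let_def split: if_splits)
  moreover have "?P ?k" using LeastI_ex[OF ex] .
  ultimately show ?thesis by (intro exI[of _ ?k]) (cases "\<epsilon> ?k"; simp)
qed

lemma sequential_test_H1D:
  assumes "sequential_test f r N \<epsilon> x = H1"
  shows "\<exists>k\<ge>1. \<epsilon> k \<le> ereal (r - emp_mean f (N k) x)"
proof -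
  let ?P = "\<lambda>k. k \<ge> 1 \<and> stops_at f r N \<epsilon> x k"
  let ?k = "LEAST k. ?P k"
  have ex: "\<exists>k. ?P k" and "\<not> ereal r + \<epsilon> ?k \<le> ereal (emp_mean f (N ?k) x)"
    using assms by (auto simp: sequential_test_def Let_def split: if_splits)
  moreover have "?P ?k" using LeastI_ex[OF ex] .
  ultimately show ?thesis by (intro exI[of _ ?k]) (cases "\<epsilon> ?k"; auto simp: stops_at_def)
qed

text \<open>The sign \<open>s = 1\<close> stands for wrongly accepting \<open>H0\<close>,
  \<open>s = -1\<close> for wrongly accepting \<open>H1\<close>. Each sign may use the whole budget
  \<open>\<alpha>\<close>, because \<open>test_err\<close> is a maximum and not a sum.\<close>

lemma sequential_test_err:
  fixes X :: "nat \<Rightarrow> 'a \<Rightarrow> 'd::finite"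
  assumes mc: "markov_chain \<Omega> K \<pi> X" and \<alpha>: "0 \<le> \<alpha>"
    and bound: "\<And>s k. s = 1 \<or> s = -1 \<Longrightarrow> \<delta> \<le> s * (r - measure_pmf.expectation \<pi> f) \<Longrightarrow> 1 \<le> k \<Longrightarrow>
      \<P>(\<omega> in \<Omega>. \<epsilon> k \<le> ereal (s * (emp_mean f (N k) (\<lambda>n. X n \<omega>) - r))) \<le> b k"
    and sum_b: "\<And>n. (\<Sum>k<n. b (Suc k)) \<le> \<alpha>"
  shows "test_err \<Omega> X \<pi> f r \<delta> (sequential_test f r N \<epsilon>) \<le> \<alpha>"
proof -
  interpret prob_space \<Omega> using mc by (simp add: markov_chain_def)
  note [measurable] = emp_mean_measurable[OF mc]
  define E where "E s k = {\<omega>\<in>space \<Omega>. \<epsilon> k \<le> ereal (s * (emp_mean f (N k) (\<lambda>n. X n \<omega>) - r))}" for s k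
  have meas: "E s k \<in> events" for s k unfolding E_def by measurable
  have union: "prob (\<Union>k. E s (Suc k)) \<le> \<alpha>"
    if "s = 1 \<or> s = -1" "\<delta> \<le> s * (r - measure_pmf.expectation \<pi> f)" for s
  proof -
    have Eb: "prob (E s (Suc k)) \<le> b (Suc k)" for k using bound[OF that, of "Suc k"] by (simp add: E_def)
    have partial: "(\<Sum>k<n. prob (E s (Suc k))) \<le> \<alpha>" for n
      by (rule order_trans[OF sum_mono sum_b]) (rule Eb)
    have "summable (\<lambda>k. prob (E s (Suc k)))"
      by (rule summableI_nonneg_bounded[where x = \<alpha>]) (use partial in auto)
    hence "prob (\<Union>k. E s (Suc k)) \<le> (\<Sum>k. prob (E s (Suc k)))"
      by (intro finite_measure_subadditive_countably) (use meas in auto)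
    also have "\<dots> \<le> \<alpha>"
      by (rule suminf_le_const[OF \<open>summable _\<close>]) (rule partial)
    finally show ?thesis .
  qed
  have UN: "\<omega> \<in> (\<Union>k. E s (Suc k))"
    if "\<omega> \<in> space \<Omega>" "\<exists>k\<ge>1. \<epsilon> k \<le> ereal (s * (emp_mean f (N k) (\<lambda>n. X n \<omega>) - r))" for s \<omega>
    using that unfolding E_def by (auto simp: Suc_le_eq gr0_conv_Suc)
  have meas_UN: "(\<Union>k. E s (Suc k)) \<in> events" for s using meas by auto
  show ?thesis
  proof (rule test_err_le[OF \<alpha>])
    assume \<mu>: "measure_pmf.expectation \<pi> f \<le> r - \<delta>"
    have "{\<omega>\<in>space \<Omega>. sequential_test f r N \<epsilon> (\<lambda>n. X n \<omega>) = H0} \<subseteq> (\<Union>k. E 1 (Suc k))"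
      by (intro subsetI UN) (auto dest!: sequential_test_H0D)
    from finite_measure_mono[OF this meas_UN] union[of 1] \<mu>
    show "\<P>(\<omega> in \<Omega>. sequential_test f r N \<epsilon> (\<lambda>n. X n \<omega>) = H0) \<le> \<alpha>" by simp
  next
    assume \<mu>: "r + \<delta> \<le> measure_pmf.expectation \<pi> f"
    have "{\<omega>\<in>space \<Omega>. sequential_test f r N \<epsilon> (\<lambda>n. X n \<omega>) = H1} \<subseteq> (\<Union>k. E (-1) (Suc k))"
      by (intro subsetI UN) (auto dest!: sequential_test_H1D)
    from finite_measure_mono[OF this meas_UN] union[of "-1"] \<mu>
    show "\<P>(\<omega> in \<Omega>. sequential_test f r N \<epsilon> (\<lambda>n. X n \<omega>) = H1) \<le> \<alpha>" by simp
  qed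
qed

section \<open>Geometric inspection times and the test without indifference zone\<close>

lemma geom_times_bounds:
  assumes "0 \<le> \<xi>"
  shows "N0 \<le> geom_times N0 \<xi> k"
    and "real (geom_times N0 \<xi> k) \<le> real N0 * (1 + \<xi>) ^ k"
    and "real N0 * (1 + \<xi>) ^ k \<le> real (geom_times N0 \<xi> k) + 1"
proof -
  have "real N0 * 1 \<le> real N0 * (1 + \<xi>) ^ k" using assms by (intro mult_left_mono) auto
  thus "N0 \<le> geom_times N0 \<xi> k" unfolding geom_times_def by (simp add: le_nat_floor)
  show "real (geom_times N0 \<xi> k) \<le> real N0 * (1 + \<xi>) ^ k"
    unfolding geom_times_def using assms by (intro of_nat_floor) simp
  show "real N0 * (1 + \<xi>) ^ k \<le> real (geom_times N0 \<xi> k) + 1"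
    unfolding geom_times_def by linarith
qed

lemma hard_test_err:
  fixes X :: "nat \<Rightarrow> 'a \<Rightarrow> 'd::finite"
  assumes mc: "markov_chain \<Omega> K \<pi> X"
    and erg: "irreducible_kernel K" "aperiodic_kernel K" "stationary K \<pi>" "reversible K \<pi>"
    and f: "\<And>i. f i \<in> {0..1}" and r: "0 < r" "r < 1"
    and \<alpha>: "0 < \<alpha>" "\<alpha> \<le> 1" and N0: "1 \<le> N0" and \<xi>: "0 < \<xi>"
  shows "test_err \<Omega> X \<pi> f r 0 (A_hard f r N0 \<xi> (eps_hard K \<pi> f \<alpha> (geom_times N0 \<xi>))) \<le> \<alpha>"
  unfolding A_hard_def
proof (rule sequential_test_err[OF mc])
  let ?\<mu> = "measure_pmf.expectation \<pi> f"
  let ?N = "geom_times N0 \<xi>"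
  interpret prob_space \<Omega> using mc by (simp add: markov_chain_def)
  note [measurable] = emp_mean_measurable[OF mc]
  \<comment> \<open>The budget is \<open>\<alpha> / (k * (k + 1))\<close>, which telescopes to at
    most \<open>\<alpha>\<close>. The terms \<open>1 + 2 * ln k\<close> of the half-width give
    \<open>exp (- L) = \<alpha> / (exp 1 * k\<^sup>2)\<close>, within this budget since
    \<open>k + 1 \<le> 2 * k\<close> and \<open>2 \<le> exp 1\<close>.\<close>
  define b where "b k = \<alpha> * (1 / real k - 1 / real (k + 1))" for k
  show "0 \<le> \<alpha>" using \<alpha> by simp
  show "(\<Sum>k<n. b (Suc k)) \<le> \<alpha>" for n
  proof -
    have "(\<Sum>k<n. b (Suc k)) = \<alpha> * (\<Sum>k<n. 1 / real (Suc k) - 1 / real (Suc (Suc k)))"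
      by (simp add: b_def sum_distrib_left)
    also have "\<dots> = \<alpha> * (1 - 1 / real (Suc n))"
      using sum_lessThan_telescope'[of "\<lambda>k. 1 / real (Suc k)" n] by simp
    also have "\<dots> \<le> \<alpha> * 1" using \<alpha> by (intro mult_left_mono) auto
    finally show ?thesis by simp
  qed
  fix s :: real and k :: nat
  assume s: "s = 1 \<or> s = -1" and hyp: "0 \<le> s * (r - ?\<mu>)" and k: "1 \<le> k"
  let ?A = "{\<omega>\<in>space \<Omega>. eps_hard K \<pi> f \<alpha> ?N k \<le> ereal (s * (emp_mean f (?N k) (\<lambda>n. X n \<omega>) - r))}"
  define L where "L = ln (1 / \<alpha>) + 1 + 2 * ln (real k)"
  define E where "E = {ereal \<epsilon> | \<epsilon>. \<epsilon> > 0 \<and> \<epsilon>\<^sup>2 / (8 * real (f_mixing_time K \<pi> f (\<epsilon> / 2))) \<ge> L / real (?N k)}"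
  have eps: "eps_hard K \<pi> f \<alpha> ?N k = Inf E" by (simp add: eps_hard_def E_def L_def)
  have N1: "1 \<le> ?N k" using geom_times_bounds(1)[of \<xi> N0 k] \<xi> N0 by simp
  have "ln \<alpha> \<le> 0" "0 \<le> ln (real k)" using \<alpha> k by simp_all
  moreover have "L = 1 - ln \<alpha> + 2 * ln (real k)" using \<alpha> by (simp add: L_def ln_div)
  ultimately have L1: "1 \<le> L" by linarith
  have "exp L = exp 1 * (real k)\<^sup>2 / \<alpha>"
    using \<alpha> k by (simp add: L_def exp_add ln_div exp_minus exp_diff field_simps exp_double)
  hence expL: "exp (- L) = \<alpha> / (exp 1 * (real k)\<^sup>2)" by (simp add: exp_minus)
  have "exp (- L) \<le> b k"
  proof -
    have "real k * (real k + 1) \<le> 2 * (real k)\<^sup>2" using k by (simp add: power2_eq_square)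
    also have "\<dots> \<le> exp 1 * (real k)\<^sup>2" using exp_ge_add_one_self[of 1] by (intro mult_right_mono) auto
    finally have "\<alpha> / (exp 1 * (real k)\<^sup>2) \<le> \<alpha> / (real k * (real k + 1))"
      using \<alpha> k by (intro divide_left_mono) auto
    also have "\<dots> = b k" using k by (simp add: b_def field_simps)
    finally show ?thesis using expL by simp
  qed
  have b0: "0 \<le> b k" using \<open>exp (- L) \<le> b k\<close> exp_ge_zero[of "- L"] by linarith
  show "prob ?A \<le> b k"
  \<comment> \<open>An infinite half-width, or one above 1, makes the event empty. Otherwise some
    trajectory forces the infimum to be at most 1.\<close>
  proof (cases "?A = {}")
    case True
    show ?thesis unfolding True using b0 by simp
  next
    case False
    then obtain \<omega> where \<omega>: "Inf E \<le> ereal (s * (emp_mean f (?N k) (\<lambda>n. X n \<omega>) - r))"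
      unfolding eps by blast
    have "s * (emp_mean f (?N k) (\<lambda>n. X n \<omega>) - r) \<le> 1"
      using s r emp_mean_in_unit_interval[of f "?N k" "\<lambda>n. X n \<omega>", OF f] by auto
    with \<omega> have Inf1: "Inf E \<le> ereal 1" by (meson ereal_less_eq(3) order_trans)
    \<comment> \<open>Since mixing times are at least 1, every element of \<open>E\<close> is at
      least \<open>e0\<close>. Thus the infimum is positive, and a multiplicative enlargement of it
      is strict.\<close>
    define e0 where "e0 = sqrt (8 * L / ?N k)"
    have e0: "0 < e0" using L1 N1 by (simp add: e0_def)
    have "ereal e0 \<le> Inf E"
    proof (rule Inf_greatest)
      fix x assume "x \<in> E"
      then obtain \<epsilon> where \<epsilon>: "x = ereal \<epsilon>" "0 < \<epsilon>"
        "L / ?N k \<le> \<epsilon>\<^sup>2 / (8 * real (f_mixing_time K \<pi> f (\<epsilon> / 2)))" by (auto simp: E_def)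
      have "1 \<le> f_mixing_time K \<pi> f (\<epsilon> / 2)"
        using \<epsilon> by (intro f_mixing_time(1)[OF erg f]) auto
      hence "\<epsilon>\<^sup>2 / (8 * real (f_mixing_time K \<pi> f (\<epsilon> / 2))) \<le> \<epsilon>\<^sup>2 / 8"
        by (intro divide_left_mono) auto
      with \<epsilon>(3) have "8 * L / ?N k \<le> \<epsilon>\<^sup>2" by simp
      thus "ereal e0 \<le> x" using \<epsilon> by (simp add: e0_def real_le_lsqrt)
    qed
    then obtain e where e: "Inf E = ereal e" "e0 \<le> e" "e \<le> 1"
      using Inf1 by (cases "Inf E") auto
    have e_pos: "0 < e" using e e0 by simp
    \<comment> \<open>The constants leave room to replace the infimum by a nearby element of \<open>E\<close>, so it need
      not be attained.\<close>
    have "Inf E < ereal (8 / 7 * e)" using e e_pos by simp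
    then obtain \<epsilon> where \<epsilon>: "0 < \<epsilon>" "\<epsilon> < 8 / 7 * e"
        "L / ?N k \<le> \<epsilon>\<^sup>2 / (8 * real (f_mixing_time K \<pi> f (\<epsilon> / 2)))"
      unfolding Inf_less_iff by (auto simp: E_def)
    let ?T = "f_mixing_time K \<pi> f (\<epsilon> / 2)"
    have T1: "1 \<le> ?T" using \<epsilon> by (intro f_mixing_time(1)[OF erg f]) auto
    have NT: "8 * real ?T * L \<le> ?N k * \<epsilon>\<^sup>2"
      using \<epsilon>(3) T1 N1 by (simp add: field_simps)
    \<comment> \<open>As \<open>(8 / 7)\<^sup>2 \<le> 8\<close> and \<open>L \<ge> 1\<close>, the
      defining inequality of \<open>E\<close> yields \<open>T \<le> N k\<close>.\<close>
    have "\<epsilon>\<^sup>2 \<le> (8 / 7)\<^sup>2" using \<epsilon> e by (intro power_mono) auto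
    hence "real (?N k) * \<epsilon>\<^sup>2 \<le> real (?N k) * 8" by (intro mult_left_mono) (auto simp: power2_eq_square)
    moreover have "8 * real ?T * 1 \<le> 8 * real ?T * L" using L1 by (intro mult_left_mono) auto
    ultimately have TN: "?T \<le> ?N k" using NT by simp
    \<comment> \<open>The factor \<open>8 / 7\<close> is explained here: from
      \<open>e > 7 / 8 * \<epsilon>\<close> the share \<open>e - \<epsilon> / 2\<close> left for the
      fluctuation exceeds \<open>3 / 8 * \<epsilon>\<close>, and
      \<open>9 / 64 \<ge> 1 / 8\<close>.\<close>
    have "\<epsilon>\<^sup>2 / 8 \<le> (3 / 8 * \<epsilon>)\<^sup>2" by (simp add: power2_eq_square)
    also have "\<dots> \<le> (e - \<epsilon> / 2)\<^sup>2" using \<epsilon> by (intro power_mono) auto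
    finally have "real (?N k) * (\<epsilon>\<^sup>2 / 8) \<le> real (?N k) * (e - \<epsilon> / 2)\<^sup>2" by (intro mult_left_mono) auto
    with NT have "L * ?T \<le> ?N k * (e - \<epsilon> / 2)\<^sup>2" by (simp add: mult_ac)
    hence exp_le: "exp (- real (?N k) * (e - \<epsilon> / 2)\<^sup>2 / ?T) \<le> exp (- L)"
      using T1 by (simp add: field_simps)
    have "prob ?A \<le> prob {\<omega>\<in>space \<Omega>. \<epsilon> / 2 + (e - \<epsilon> / 2) \<le> s * (emp_mean f (?N k) (\<lambda>n. X n \<omega>) - ?\<mu>)}"
      unfolding eps e(1) by (intro finite_measure_mono) (use hyp in \<open>auto simp: algebra_simps\<close>)
    also have "\<dots> \<le> exp (- real (?N k) * (e - \<epsilon> / 2)\<^sup>2 / ?T)"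
      by (rule f_mixing_time_tail[OF mc erg f s _ _ TN]) (use \<epsilon> in auto)
    also note exp_le
    also note \<open>exp (- L) \<le> b k\<close>
    finally show ?thesis .
  qed
qed

section \<open>The sequential test with an indifference zone\<close>

text \<open>Here \<open>x\<close> belongs to a rounded inspection time and \<open>z\<close> to the
  unrounded one. The expression \<open>x + 1 / x\<close> is not monotone, but rounding increases it
  by at most 1, and \<open>1 + u \<le> exp u\<close> absorbs this while turning exponential decay
  into a summable reciprocal.\<close>

lemma exp_symmetric_le:
  fixes x z l :: real
  assumes x: "0 < x" "x \<le> z" "z \<le> x + 1" and l: "1 \<le> l"
  shows "exp (- (4 * l * (2 + x + 1 / x))) \<le> exp (- 2 * l) / (2 + z + 1 / z)"
proof -
  define u where "u = 2 + x + 1 / x"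
  have u: "2 \<le> u" using x by (simp add: u_def)
  have "1 / z \<le> 1 / x" using x by (intro divide_left_mono) auto
  hence "2 + z + 1 / z \<le> 1 + u" using x by (simp add: u_def)
  also have "\<dots> \<le> exp u" by (rule exp_ge_add_one_self)
  finally have w: "2 + z + 1 / z \<le> exp u" .
  have "2 * l * 2 \<le> 2 * l * u" using u l by (intro mult_left_mono) auto
  moreover have "1 * u \<le> 2 * l * u" using u l by (intro mult_right_mono) auto
  ultimately have "- (4 * l * u) \<le> - 2 * l - u" using l by linarith
  hence "exp (- (4 * l * u)) \<le> exp (- 2 * l) / exp u" by (simp flip: exp_diff)
  also have "\<dots> \<le> exp (- 2 * l) / (2 + z + 1 / z)"
    using w x by (intro divide_left_mono) (auto intro!: mult_pos_pos add_pos_pos)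
  finally show ?thesis by (simp add: u_def)
qed

text \<open>
  The exponents of the sequential test have the form \<open>z + 1 / z\<close> along a geometric progression;
  comparing with increments of \<open>z / (1 + z)\<close> bounds their sum independently of where the
  progression starts.
\<close>

lemma geometric_telescope_bound:
  fixes z \<xi> :: real
  assumes z: "0 < z" and \<xi>: "0 < \<xi>"
  shows "\<xi> / (1 + \<xi>) / (2 + z + 1 / z) \<le> (1 + \<xi>) * z / (1 + (1 + \<xi>) * z) - z / (1 + z)"
proof -
  \<comment> \<open>The reciprocal \<open>z / (1 + z)\<^sup>2\<close> is the derivative of
    \<open>z / (1 + z)\<close> with respect to \<open>ln z\<close>, so along a geometric progression
    its values behave like increments of a function bounded by 1.\<close>
  have "2 + z + 1 / z = (1 + z)\<^sup>2 / z" using z by (simp add: field_simps power2_eq_square)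
  hence "\<xi> / (1 + \<xi>) / (2 + z + 1 / z) = \<xi> * z / ((1 + z) * ((1 + \<xi>) * (1 + z)))"
    using z by (simp add: power2_eq_square mult_ac)
  also have "\<dots> \<le> \<xi> * z / ((1 + z) * (1 + (1 + \<xi>) * z))"
    using z \<xi> by (intro divide_left_mono mult_left_mono mult_pos_pos) (auto simp: algebra_simps add_pos_pos)
  also have "\<dots> = (1 + \<xi>) * z / (1 + (1 + \<xi>) * z) - z / (1 + z)"
  proof -
    have "1 + z \<noteq> 0" "1 + (1 + \<xi>) * z \<noteq> 0" using z \<xi> by (auto simp: add_pos_pos add_nonneg_eq_0_iff)
    thus ?thesis by (simp add: diff_frac_eq) (simp add: algebra_simps)
  qed
  finally show ?thesis .
qed

lemma seq_test_err:
  fixes X :: "nat \<Rightarrow> 'a \<Rightarrow> 'd::finite"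
  assumes mc: "markov_chain \<Omega> K \<pi> X"
    and erg: "irreducible_kernel K" "aperiodic_kernel K" "stationary K \<pi>" "reversible K \<pi>"
    and f: "\<And>i. f i \<in> {0..1}" and r: "0 < r" "r < 1"
    and \<alpha>: "0 < \<alpha>" "\<alpha> \<le> 2 / 5" and \<delta>: "0 < \<delta>" "\<delta> \<le> 1" and \<xi>: "0 < \<xi>" "\<xi> \<le> 2 / 5"
  shows "test_err \<Omega> X \<pi> f r \<delta> (A_seq f r (M_seq K \<pi> f \<alpha> \<delta> \<xi>) \<xi>) \<le> \<alpha>"
  unfolding A_seq_def
proof (rule sequential_test_err[OF mc])
  let ?\<mu> = "measure_pmf.expectation \<pi> f"
  let ?T = "f_mixing_time K \<pi> f (\<delta> / 2)"
  interpret prob_space \<Omega> using mc by (simp add: markov_chain_def)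
  note [measurable] = emp_mean_measurable[OF mc]
  define M where "M = M_seq K \<pi> f \<alpha> \<delta> \<xi>"
  define N where "N = seq_times r M \<xi>"
  define l where "l = ln (2 / sqrt (\<alpha> * \<xi>))"
  define N0 where "N0 = nat \<lfloor>M * min (1 / r) (1 / (1 - r))\<rfloor>"
  \<comment> \<open>This is \<open>\<delta> * N k / (2 * M)\<close> with the rounding of
    \<open>N k\<close> removed, so it is exactly geometric in \<open>k\<close>. The value 1, where
    \<open>z + 1 / z\<close> is smallest, corresponds to about \<open>2 * M / \<delta>\<close>
    samples, the least favourable time for the bound.\<close>
  define z where "z k = \<delta> * (real N0 * (1 + \<xi>) ^ k) / (2 * M)" for k
  define b where "b k = \<alpha> * (z (Suc k) / (1 + z (Suc k)) - z k / (1 + z k))" for k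
  have T1: "1 \<le> ?T" using \<delta> by (intro f_mixing_time(1)[OF erg f]) auto
  \<comment> \<open>Both bounds \<open>2 / 5\<close> combine to
    \<open>2 / sqrt (\<alpha> * \<xi>) \<ge> 5\<close>, whence \<open>l \<ge> 1\<close>.\<close>
  have "\<alpha> * \<xi> \<le> (2 / 5) * (2 / 5)" using \<alpha> \<xi> by (intro mult_mono) auto
  hence "sqrt (\<alpha> * \<xi>) \<le> 2 / 5" by (intro real_le_lsqrt) (auto simp: power2_eq_square)
  hence "5 \<le> 2 / sqrt (\<alpha> * \<xi>)" using \<alpha> \<xi> by (simp add: field_simps)
  hence "exp 1 \<le> 2 / sqrt (\<alpha> * \<xi>)" using exp_le by linarith
  hence l1: "1 \<le> l" unfolding l_def using \<alpha> \<xi> by (subst ln_ge_iff) auto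
  have "exp l = 2 / sqrt (\<alpha> * \<xi>)" using \<alpha> \<xi> by (simp add: l_def)
  hence "exp (2 * l) = 4 / (\<alpha> * \<xi>)"
    using \<alpha> \<xi> by (simp add: exp_double power_divide)
  hence exp_l: "exp (- 2 * l) = \<alpha> * \<xi> / 4" by (simp add: exp_minus)
  have M: "M * \<delta> = 8 * real ?T * l" using \<delta> by (simp add: M_def M_seq_def l_def)
  have "8 * real ?T * 1 \<le> 8 * real ?T * l" using l1 by (intro mult_left_mono) auto
  hence M8: "8 * real ?T \<le> M * \<delta>" using M by simp
  moreover have "1 \<le> real ?T" using T1 by simp
  ultimately have "0 < M * \<delta>" by linarith
  hence M_pos: "0 < M" using \<delta> by (simp add: zero_less_mult_iff)
  \<comment> \<open>Since \<open>1 / r\<close> and \<open>1 / (1 - r)\<close> are at least 1,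
    \<open>M \<ge> 8 * T\<close> makes even the initial \<open>N0\<close> at least \<open>T\<close>;
    every inspection time is then admissible for the tail bound.\<close>
  have "M * \<delta> \<le> M * 1" using M_pos \<delta> by (intro mult_left_mono) auto
  with M8 have TM: "8 * real ?T \<le> M" by simp
  have "M * 1 \<le> M * min (1 / r) (1 / (1 - r))" using r M_pos by (intro mult_left_mono) auto
  with TM have "real ?T \<le> M * min (1 / r) (1 / (1 - r))" by simp
  hence TN0: "?T \<le> N0" unfolding N0_def by (simp add: le_nat_floor)
  have z_pos: "0 < z k" for k
    using TN0 T1 \<delta> M_pos \<xi> by (simp add: z_def)
  have z_Suc: "z (Suc k) = (1 + \<xi>) * z k" for k by (simp add: z_def)
  show "0 \<le> \<alpha>" using \<alpha> by simp
  show "(\<Sum>k<n. b (Suc k)) \<le> \<alpha>" for n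
  proof -
    have "(\<Sum>k<n. b (Suc k)) = \<alpha> * (z (Suc n) / (1 + z (Suc n)) - z 1 / (1 + z 1))"
      using sum_lessThan_telescope[of "\<lambda>k. z (Suc k) / (1 + z (Suc k))" n]
      by (simp add: b_def flip: sum_distrib_left)
    also have "\<dots> \<le> \<alpha> * (1 - 0)"
      using \<alpha> z_pos[of "Suc n"] z_pos[of 1] by (intro mult_left_mono diff_mono) auto
    finally show ?thesis by simp
  qed
  fix s :: real and k :: nat
  assume s: "s = 1 \<or> s = -1" and hyp: "\<delta> \<le> s * (r - ?\<mu>)"
  have N: "N0 \<le> N k" "real (N k) \<le> N0 * (1 + \<xi>) ^ k" "N0 * (1 + \<xi>) ^ k \<le> real (N k) + 1"
    using geom_times_bounds[of \<xi> N0 k] \<xi> by (simp_all add: N_def seq_times_def N0_def)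
  have N_pos: "0 < N k" using N(1) TN0 T1 by simp
  define x where "x = \<delta> * N k / (2 * M)"
  have x_pos: "0 < x" using \<delta> M_pos N_pos by (simp add: x_def)
  have xz: "x \<le> z k" unfolding x_def z_def
    using \<delta> M_pos N(2) by (intro divide_right_mono mult_left_mono) auto
  have zx: "z k \<le> x + 1"
  proof -
    have "z k \<le> \<delta> * (real (N k) + 1) / (2 * M)"
      unfolding z_def using \<delta> M_pos N(3) by (intro divide_right_mono mult_left_mono) auto
    also have "\<dots> = x + \<delta> / (2 * M)" by (simp add: x_def add_divide_distrib distrib_left)
    also have "\<delta> / (2 * M) \<le> 1" using \<delta> TM T1 M_pos by (simp add: divide_le_eq)
    finally show ?thesis by simp
  qed
  \<comment> \<open>A wrong crossing deviates from the mean by at least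
    \<open>\<delta> + M / N k\<close>; half of \<open>\<delta>\<close> covers the bias and the rest
    is the fluctuation.\<close>
  have "{\<omega>\<in>space \<Omega>. ereal M / ereal (real (N k)) \<le> ereal (s * (emp_mean f (N k) (\<lambda>n. X n \<omega>) - r))} \<subseteq>
    {\<omega>\<in>space \<Omega>. \<delta> / 2 + (\<delta> / 2 + M / N k) \<le> s * (emp_mean f (N k) (\<lambda>n. X n \<omega>) - ?\<mu>)}"
    using N_pos hyp by (auto simp: algebra_simps)
  hence "\<P>(\<omega> in \<Omega>. ereal M / ereal (real (N k)) \<le> ereal (s * (emp_mean f (N k) (\<lambda>n. X n \<omega>) - r))) \<le>
    \<P>(\<omega> in \<Omega>. \<delta> / 2 + (\<delta> / 2 + M / N k) \<le> s * (emp_mean f (N k) (\<lambda>n. X n \<omega>) - ?\<mu>))"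
    by (rule finite_measure_mono) measurable
  also have "\<dots> \<le> exp (- real (N k) * (\<delta> / 2 + M / N k)\<^sup>2 / ?T)"
    by (rule f_mixing_time_tail[OF mc erg f s]) (use \<delta> M_pos TN0 N in auto)
  also have "- real (N k) * (\<delta> / 2 + M / N k)\<^sup>2 / ?T = - (4 * l * (2 + x + 1 / x))"
  proof -
    have "4 * l = M * \<delta> / (2 * ?T)" using M T1 by simp
    hence "4 * l * (2 + x + 1 / x) = M * \<delta> * (2 + x + 1 / x) / (2 * ?T)" by simp
    also have "M * \<delta> * (2 + x + 1 / x) = 2 * (real (N k) * (\<delta> / 2 + M / N k)\<^sup>2)"
      using \<delta> M_pos N_pos by (simp add: x_def field_simps power2_eq_square)
    finally show ?thesis by simp
  qed
  also have "exp (- (4 * l * (2 + x + 1 / x))) \<le> exp (- 2 * l) / (2 + z k + 1 / z k)"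
    by (rule exp_symmetric_le[OF x_pos xz zx l1])
  \<comment> \<open>The \<open>\<xi>\<close> under the square root in \<open>M\<close> supplies the
    factor \<open>\<xi>\<close> that the telescoping estimate consumes;
    \<open>(1 + \<xi>) / 4 \<le> 1\<close> is slack.\<close>
  also have "\<dots> = \<alpha> * ((1 + \<xi>) / 4) * (\<xi> / (1 + \<xi>) / (2 + z k + 1 / z k))"
    unfolding exp_l using \<xi> by simp
  also have "\<dots> \<le> \<alpha> * 1 * (\<xi> / (1 + \<xi>) / (2 + z k + 1 / z k))"
    using \<alpha> \<xi> z_pos[of k] by (intro mult_right_mono mult_left_mono) auto
  also have "\<dots> \<le> \<alpha> * 1 * (z (Suc k) / (1 + z (Suc k)) - z k / (1 + z k))"
    unfolding z_Suc using \<alpha> by (intro mult_left_mono geometric_telescope_bound z_pos \<xi>) auto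
  also have "\<dots> = b k" by (simp add: b_def)
  finally show "\<P>(\<omega> in \<Omega>. ereal (M_seq K \<pi> f \<alpha> \<delta> \<xi>) /
      ereal (real (seq_times r (M_seq K \<pi> f \<alpha> \<delta> \<xi>) \<xi> k))
      \<le> ereal (s * (emp_mean f (seq_times r (M_seq K \<pi> f \<alpha> \<delta> \<xi>) \<xi> k) (\<lambda>n. X n \<omega>) - r))) \<le> b k"
    by (simp add: M_def N_def)
qed

theorem theorem3:
  fixes \<Omega> :: "'a measure" and X :: "nat \<Rightarrow> 'a \<Rightarrow> 'd::finite"
    and K :: "'d \<Rightarrow> 'd pmf" and \<pi> :: "'d pmf" and f :: "'d \<Rightarrow> real" and r \<alpha> :: real
  assumes "markov_chain \<Omega> K \<pi> X"
    and "irreducible_kernel K" and "aperiodic_kernel K"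
    and "stationary K \<pi>" and "reversible K \<pi>"
    and "\<forall>i. f i \<in> {0..1}"
    and "0 < r" and "r < 1" and "0 < \<alpha>" and "\<alpha> \<le> 2 / 5"
  shows "(\<forall>\<delta>. 0 < \<delta> \<and>
            \<delta> < min (measure_pmf.expectation \<pi> f) (1 - measure_pmf.expectation \<pi> f) \<longrightarrow>
            test_err \<Omega> X \<pi> f r \<delta> (A_fixed f r \<delta> (N_fixed K \<pi> f \<alpha> \<delta>)) \<le> \<alpha>) \<and>
         (\<forall>\<delta> \<xi>. 0 < \<delta> \<and>
            \<delta> < min (measure_pmf.expectation \<pi> f) (1 - measure_pmf.expectation \<pi> f) \<and>
            0 < \<xi> \<and> \<xi> < 2 / 5 \<longrightarrow>
            test_err \<Omega> X \<pi> f r \<delta> (A_seq f r (M_seq K \<pi> f \<alpha> \<delta> \<xi>) \<xi>) \<le> \<alpha>) \<and>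
         (\<forall>N0 \<xi>. 1 \<le> N0 \<and> 0 < \<xi> \<and> \<xi> < 2 / 5 \<longrightarrow>
            test_err \<Omega> X \<pi> f r 0
              (A_hard f r N0 \<xi> (eps_hard K \<pi> f \<alpha> (geom_times N0 \<xi>))) \<le> \<alpha>)"
proof (intro conjI allI impI)
  note mc = assms(1) and erg = assms(2-5)
  have f: "f i \<in> {0..1}" for i using assms(6) by blast
  let ?\<mu> = "measure_pmf.expectation \<pi> f"
  {
    fix \<delta> :: real
    assume "0 < \<delta> \<and> \<delta> < min ?\<mu> (1 - ?\<mu>)"
    \<comment> \<open>Adding \<open>\<delta> < \<mu>\<close> and \<open>\<delta> < 1 - \<mu>\<close>
      gives \<open>\<delta> < 1 / 2\<close>.\<close>
    hence \<delta>: "0 < \<delta>" "\<delta> \<le> 1" by auto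
    show "test_err \<Omega> X \<pi> f r \<delta> (A_fixed f r \<delta> (N_fixed K \<pi> f \<alpha> \<delta>)) \<le> \<alpha>"
      by (rule fixed_test_err[OF mc erg f assms(9,10) \<delta>])
  next
    fix \<delta> \<xi> :: real
    assume "0 < \<delta> \<and> \<delta> < min ?\<mu> (1 - ?\<mu>) \<and> 0 < \<xi> \<and> \<xi> < 2 / 5"
    hence "0 < \<delta>" "\<delta> \<le> 1" "0 < \<xi>" "\<xi> \<le> 2 / 5" by auto
    thus "test_err \<Omega> X \<pi> f r \<delta> (A_seq f r (M_seq K \<pi> f \<alpha> \<delta> \<xi>) \<xi>) \<le> \<alpha>"
      by (rule seq_test_err[OF mc erg f assms(7-10)])
  next
    fix N0 :: nat and \<xi> :: real
    assume "1 \<le> N0 \<and> 0 < \<xi> \<and> \<xi> < 2 / 5"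
    thus "test_err \<Omega> X \<pi> f r 0
        (A_hard f r N0 \<xi> (eps_hard K \<pi> f \<alpha> (geom_times N0 \<xi>))) \<le> \<alpha>"
      using assms(7-10) by (intro hard_test_err[OF mc erg f]) auto
  }
qed

end
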